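(* Let $u\in\mathbf{K}[x,y,z]$, $h\in\mathbf{K}[x,y]$, let $v(x,y,t)\in\mathbf{K}[x,y,t]$ be a polynomial in three variables, and let $H=(u(x,y,z),\,v(x,y,u(x,y,z)),\,h(x,y))$, a polynomial map over $\mathbf{K}[x,y,z]$. Assume that $H(0)=0$ and that the components of $H$ are linearly independent over $\mathbf{K}$. If $JH$ is nilpotent and $\gcd(\deg v(x,y,0),\deg h)\leq 3$, then there exists $T\in\operatorname{GL}_3(\mathbf{K})$ such that $T^{-1}HT=(U,V,W)$ with $$U=u_1z-a^{-1}b'(y)\,g(ax+b(y))-u_1l_2y,\qquad V=g(ax+b(y)),\qquad W=c_0V^2+l_2V,$$ where $b(y)=u_1c_0ay^2+l_1y+\tilde{l}_2$ for some $u_1,c_0,a\in\mathbf{K}^*$ and $l_1,l_2,\tilde{l}_2\in\mathbf{K}$, and $g(t)\in\mathbf{K}[t]$ satisfies $g(0)=0$ and $\deg_t g(t)\geq 1$.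
   Context: $\mathbf{K}$ is an algebraically closed field and $\mathbf{K}^*=\mathbf{K}\setminus\{0\}$. $JH$ denotes the $3\times 3$ Jacobian matrix of $H$ with respect to $(x,y,z)$. $\deg$ is the total degree; $v(x,y,0)$ is obtained from $v(x,y,t)$ by setting the third variable $t$ equal to $0$. $T$ is identified with the linear map it defines on $\mathbf{K}^3$, and $T^{-1}HT$ is the composition $T^{-1}\circ H\circ T$.
   Formalization: K is additionally assumed to have characteristic 0; the claim fails over every K of characteristic p > 0: H=(z^2,x^2,y^2) for p=2, and H=(z^p,y^p,x) for p≥3, satisfy all hypotheses but have no such normal form. *)

theory Defs
  imports "HOL-Analysis.Analysis" "HOL-Computational_Algebra.Computational_Algebra"
begin

text \<open>
  Polynomial rings are iterated: \<open>K[x]\<close>, \<open>K[x,y] = K[x][y]\<close> and \<open>K[x,y,z] = K[x][y][z]\<close>. The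
  outermost \<open>poly\<close> carries the last variable. Hence for \<open>v\<close> in \<open>K[x,y,t]\<close> and \<open>u\<close> in \<open>K[x,y,z]\<close>
  the polynomial \<open>v(x,y,u)\<close> is \<open>pcompose v u\<close>, the polynomial \<open>v(x,y,0)\<close> is \<open>poly v 0\<close>, and
  \<open>h\<close> in \<open>K[x,y]\<close> is regarded as the element \<open>[:h:]\<close> of \<open>K[x,y,z]\<close>.
\<close>

type_synonym 'a poly2 = "'a poly poly"
type_synonym 'a poly3 = "'a poly poly poly"

definition Const3 :: "'a::field \<Rightarrow> 'a poly3" where
  "Const3 c = [:[:[:c:]:]:]"

abbreviation X3 :: "'a::field poly3" where "X3 \<equiv> [:[:[:0, 1:]:]:]"
abbreviation Y3 :: "'a::field poly3" where "Y3 \<equiv> [:[:0, 1:]:]"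
abbreviation Z3 :: "'a::field poly3" where "Z3 \<equiv> [:0, 1:]"

definition Var3 :: "'a::field poly3 ^ 3" where
  "Var3 = vector [X3, Y3, Z3]"

text \<open>The total degree on \<open>K[x,y]\<close>; as for \<^const>\<open>degree\<close>, the zero polynomial has degree 0.\<close>

definition total_degree2 :: "'a::field poly2 \<Rightarrow> nat" where
  "total_degree2 p = (if p = 0 then 0 else Max {i + j | i j. coeff (coeff p j) i \<noteq> 0})"

text \<open>\<open>p(q)\<close> for \<open>p\<close> in \<open>K[t]\<close> and \<open>q\<close> in \<open>K[x,y,z]\<close>.\<close>

definition subst1 :: "'a::field poly \<Rightarrow> 'a poly3 \<Rightarrow> 'a poly3" where
  "subst1 p q = poly (map_poly Const3 p) q"

text \<open>\<open>p(G\<^sub>1, G\<^sub>2, G\<^sub>3)\<close> for \<open>p\<close> in \<open>K[x,y,z]\<close>.\<close>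

definition subst3 :: "'a::field poly3 \<Rightarrow> 'a poly3 ^ 3 \<Rightarrow> 'a poly3" where
  "subst3 p G =
     poly (map_poly (\<lambda>q. poly (map_poly (\<lambda>r. subst1 r (G $ 1)) q) (G $ 2)) p) (G $ 3)"

text \<open>A polynomial map of \<open>K\<^sup>3\<close> is the vector of its three components.\<close>

type_synonym 'a polymap = "'a poly3 ^ 3"

definition pm_comp :: "'a::field polymap \<Rightarrow> 'a polymap \<Rightarrow> 'a polymap" where
  "pm_comp F G = (\<chi> i. subst3 (F $ i) G)"

definition pm_eval :: "'a::field polymap \<Rightarrow> 'a ^ 3 \<Rightarrow> 'a ^ 3" where
  "pm_eval F p = (\<chi> i. poly (poly (poly (F $ i) [:[:p $ 3:]:]) [:p $ 2:]) (p $ 1))"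

definition pm_linear :: "'a::field ^ 3 ^ 3 \<Rightarrow> 'a polymap" where
  "pm_linear T = (\<chi> i. \<Sum>j\<in>UNIV. Const3 (T $ i $ j) * Var3 $ j)"

definition pm_conj :: "'a::field ^ 3 ^ 3 \<Rightarrow> 'a polymap \<Rightarrow> 'a polymap" where
  "pm_conj T H = pm_comp (pm_linear (matrix_inv T)) (pm_comp H (pm_linear T))"

definition pm_lin_indep :: "'a::field polymap \<Rightarrow> bool" where
  "pm_lin_indep H \<longleftrightarrow>
     (\<forall>c :: 'a ^ 3. (\<Sum>i\<in>UNIV. Const3 (c $ i) * H $ i) = 0 \<longrightarrow> c = 0)"

text \<open>
  The partial derivatives with respect to \<open>x\<close>, \<open>y\<close>, \<open>z\<close>: the library's \<^const>\<open>pderiv\<close> differentiates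
  with respect to the outermost variable, the other two are obtained coefficientwise.
\<close>

definition grad3 :: "'a::field poly3 \<Rightarrow> 'a poly3 ^ 3" where
  "grad3 p = vector [map_poly (map_poly pderiv) p, map_poly pderiv p, pderiv p]"

definition jacobian :: "'a::field polymap \<Rightarrow> 'a poly3 ^ 3 ^ 3" where
  "jacobian H = (\<chi> i. grad3 (H $ i))"

text \<open>The iterate is the matrix power: the type class product on \<open>vec\<close> is not matrix multiplication.\<close>

definition nilpotent_matrix :: "'b::comm_ring_1 ^ 'n::finite ^ 'n \<Rightarrow> bool" where
  "nilpotent_matrix A \<longleftrightarrow> (\<exists>k. (((**) A) ^^ k) (mat 1) = 0)"

end

theory Submission
  imports Defs
begin

text \<open>
  Nilpotency of \<open>JH\<close> amounts to three polynomial equations (trace, sum of the principal minors and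
  determinant vanish). If \<open>u\<close> does not depend on \<open>z\<close>, then \<open>(u, v(x,y,u))\<close> is a planar map with
  nilpotent Jacobian, so its components are linearly dependent. Otherwise the determinant shows
  that \<open>h\<close> and all coefficients of \<open>v\<close> in \<open>t\<close> have pairwise vanishing Jacobian determinants, and
  comparing degrees in \<open>z\<close> forces \<open>v = v\<^sub>0(x,y) + ct\<close> with \<open>c\<close> constant. A shear removes \<open>ct\<close>, and
  then \<open>u = u\<^sub>1z - P(x,y)\<close> with \<open>P\<^sub>x = v\<^sub>y\<close> and \<open>v\<^sub>y\<^sup>2 + u\<^sub>1h\<^sub>x = v\<^sub>xP\<^sub>y\<close>. These equations say that
  the level curves of \<open>v\<close> are parabolas \<open>x = A + By + Cy\<^sup>2\<close>. Parabolas belonging to different values of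
  \<open>v\<close> are disjoint, so over an algebraically closed field they have the same \<open>B\<close> and \<open>C\<close>, whence
  \<open>v = g(x - By - Cy\<^sup>2)\<close>; the formulas for \<open>P\<close> and \<open>h\<close> follow by integration.
\<close>

no_notation fps_nth (infixl "$" 75)

section \<open>Nilpotent matrices of size three\<close>

lemma matrix_diff_ldistrib: "A ** (B - C) = A ** B - A ** C" for A :: "'b::ring_1 ^ 'n ^ 'm"
  by (simp add: vec_eq_iff matrix_matrix_mult_def algebra_simps sum_subtractf)

lemma matrix_diff_rdistrib: "(A - B) ** C = A ** C - B ** C" for A :: "'b::ring_1 ^ 'n ^ 'm"
  by (simp add: vec_eq_iff matrix_matrix_mult_def algebra_simps sum_subtractf)

text \<open>Geometric series: \<open>C\<close> is 1 + B + ... + B^(k-1), built by passing from C to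
  1 + BC. Once B^k vanishes, it inverts 1 - B.\<close>

lemma one_minus_matrix_power:
  fixes B :: "'b::comm_ring_1 ^ 'n ^ 'n"
  shows "\<exists>C. (mat 1 - B) ** C = mat 1 - (((**) B) ^^ k) (mat 1)"
proof (induction k)
  case 0
  then show ?case by (intro exI[of _ 0]) simp
next
  case (Suc k)
  then obtain C where C: "(mat 1 - B) ** C = mat 1 - (((**) B) ^^ k) (mat 1)" by blast
  have comm: "(mat 1 - B) ** B = B ** (mat 1 - B)"
    by (simp add: matrix_diff_ldistrib matrix_diff_rdistrib)
  have "(mat 1 - B) ** (mat 1 + B ** C) = (mat 1 - B) + B ** ((mat 1 - B) ** C)"
    by (simp only: matrix_add_ldistrib matrix_mul_rid matrix_mul_assoc comm)
  also have "\<dots> = mat 1 - (((**) B) ^^ Suc k) (mat 1)"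
    unfolding C by (simp add: matrix_diff_ldistrib)
  finally show ?case by blast
qed

text \<open>If \<open>A\<close> is nilpotent then \<open>1 - tA\<close> is invertible over \<open>R[t]\<close>, so its determinant is a unit of
  \<open>R[t]\<close> and hence does not depend on \<open>t\<close>.\<close>

lemma nilpotent_matrix_3:
  fixes A :: "'b::idom ^ 3 ^ 3"
  assumes "nilpotent_matrix A"
  shows "A$1$1 + A$2$2 + A$3$3 = 0"
    and "A$1$1 * A$2$2 - A$1$2 * A$2$1 + (A$1$1 * A$3$3 - A$1$3 * A$3$1)
           + (A$2$2 * A$3$3 - A$2$3 * A$3$2) = 0"
    and "det A = 0"
proof -
  obtain k where k: "(((**) A) ^^ k) (mat 1) = 0"
    using assms by (auto simp: nilpotent_matrix_def)
  define B :: "'b poly ^ 3 ^ 3" where "B = (\<chi> i j. monom (A$i$j) 1)"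
  have pow: "(((**) B) ^^ n) (mat 1) = (\<chi> i j. monom ((((**) A) ^^ n) (mat 1) $ i $ j) n)" for n
  proof (induction n)
    case 0
    then show ?case by (auto simp: vec_eq_iff mat_def)
  next
    case (Suc n)
    then show ?case
      by (auto simp: vec_eq_iff matrix_matrix_mult_def B_def mult_monom monom_sum)
  qed
  obtain C where "(mat 1 - B) ** C = mat 1 - (((**) B) ^^ k) (mat 1)"
    using one_minus_matrix_power by blast
  then have "(mat 1 - B) ** C = mat 1"
    unfolding pow k by (simp add: vec_eq_iff)
  then have "det (mat 1 - B) * det C = 1"
    by (metis det_I det_mul)
  then have "degree (det (mat 1 - B)) = 0"
    by (metis degree_1 degree_mult_eq_0 mult_zero_left mult_zero_right zero_neq_one)
  then obtain e where e: "det (mat 1 - B) = [:e:]" by (metis degree_eq_zeroE)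
  define a1 where "a1 = A$1$1 + A$2$2 + A$3$3"
  define a2 where "a2 = A$1$1 * A$2$2 - A$1$2 * A$2$1 + (A$1$1 * A$3$3 - A$1$3 * A$3$1)
           + (A$2$2 * A$3$3 - A$2$3 * A$3$2)"
  have B: "B$i$j = [:0, A$i$j:]" for i j by (simp add: B_def monom_Suc monom_0)
  \<comment> \<open>The reversed characteristic polynomial of \<open>A\<close>; comparison with the
    constant \<open>[:e:]\<close> kills every coefficient but the first.\<close>
  have "det (mat 1 - B) = [:1, - a1, a2, - det A:]"
    unfolding det_3 a1_def a2_def
    by (simp add: mat_def B one_pCons algebra_simps)
  with e show "A$1$1 + A$2$2 + A$3$3 = 0"
    and "A$1$1 * A$2$2 - A$1$2 * A$2$1 + (A$1$1 * A$3$3 - A$1$3 * A$3$1)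
           + (A$2$2 * A$3$3 - A$2$3 * A$3$2) = 0"
    and "det A = 0"
    by (simp_all add: flip: a1_def a2_def)
qed

section \<open>Derivations\<close>

text \<open>Every partial derivative of an iterated polynomial ring is \<open>pderiv\<close> carried
  through some layers of coefficients. Derivations lift coefficientwise
  (\<open>derivation_map_poly\<close>), so one locale serves all of them.\<close>

locale derivation =
  fixes D :: "'b::idom \<Rightarrow> 'b"
  assumes add: "D (a + b) = D a + D b"
    and mult: "D (a * b) = a * D b + b * D a"
begin

lemma zero [simp]: "D 0 = 0"
  by (metis add add_0 add_cancel_right_left)

lemma one [simp]: "D 1 = 0"
  by (metis add_cancel_right_right mult mult_1)

lemma minus: "D (- a) = - D a"
  using add[of a "- a"] by (simp add: eq_neg_iff_add_eq_0 add.commute)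

lemma diff: "D (a - b) = D a - D b"
  using add[of a "- b"] by (simp add: minus)

lemma sum: "D (sum f A) = (\<Sum>i\<in>A. D (f i))"
  by (induction A rule: infinite_finite_induct) (simp_all add: add)

lemma of_nat [simp]: "D (of_nat n) = 0"
  by (induction n) (simp_all add: add)

lemma numeral [simp]: "D (numeral n) = 0"
  by (metis of_nat of_nat_numeral)

lemma power2: "D (a ^ 2) = 2 * a * D a"
  by (simp add: power2_eq_square mult algebra_simps)

lemma coeff [simp]: "coeff (map_poly D p) n = D (coeff p n)"
  by (simp add: coeff_map_poly)

lemma map_const [simp]: "map_poly D [:a:] = [:D a:]"
  by (simp add: map_poly_pCons)

lemma map_pCons [simp]: "map_poly D (pCons a p) = pCons (D a) (map_poly D p)"
  by (simp add: map_poly_pCons)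

lemma derivation_map_poly: "derivation (map_poly D)"
proof
  fix p q :: "'b poly"
  show "map_poly D (p + q) = map_poly D p + map_poly D q"
    by (simp add: poly_eq_iff add)
  have *: "(\<Sum>i\<le>n. coeff q i * D (coeff p (n - i))) = (\<Sum>i\<le>n. D (coeff p i) * coeff q (n - i))" for n
    by (rule sum.reindex_bij_witness[of _ "\<lambda>i. n - i" "\<lambda>i. n - i"]) (auto simp: mult.commute)
  show "map_poly D (p * q) = p * map_poly D q + q * map_poly D p"
    by (simp add: poly_eq_iff coeff_mult sum mult sum.distrib * mult.commute)
qed

lemma map_pderiv: "map_poly D (pderiv p) = pderiv (map_poly D p)"
  by (simp add: poly_eq_iff coeff_pderiv mult of_nat del: of_nat_Suc)

text \<open>Chain rule with two sources of variation, the coefficients of \<open>p\<close> and the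
  inner polynomial \<open>q\<close>. It gives the x- and y-derivatives of v(x,y,u).\<close>

lemma map_pcompose:
  "map_poly D (pcompose p q)
     = pcompose (map_poly D p) q + pcompose (pderiv p) q * map_poly D q"
proof -
  interpret M: derivation "map_poly D" by (rule derivation_map_poly)
  show ?thesis
    by (induction p)
      (simp_all add: pcompose_pCons M.add M.mult pderiv_pCons pcompose_add algebra_simps)
qed

end

lemma derivation_pderiv: "derivation (pderiv :: 'b::idom poly \<Rightarrow> 'b poly)"
  by standard (simp_all add: pderiv_add pderiv_mult)

section \<open>Substitution homomorphisms\<close>

text \<open>Substitutions are nested evaluations with mapped coefficients;
  \<open>comm_ring_map_eval\<close> carries the homomorphism property through one level of
  nesting.\<close>

locale comm_ring_map =
  fixes f :: "'b::comm_ring_1 \<Rightarrow> 'c::comm_ring_1"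
  assumes add: "f (a + b) = f a + f b"
    and mult: "f (a * b) = f a * f b"
    and one [simp]: "f 1 = 1"
begin

lemma zero [simp]: "f 0 = 0"
  by (metis add add_0 add_cancel_right_left)

lemma minus: "f (- a) = - f a"
  by (metis add add.right_inverse add_eq_0_iff zero)

lemma diff: "f (a - b) = f a - f b"
  using add[of a "- b"] by (simp add: minus)

lemma power: "f (a ^ n) = f a ^ n"
  by (induction n) (simp_all add: mult)

lemma of_nat [simp]: "f (of_nat n) = of_nat n"
  by (induction n) (simp_all add: add)

lemma numeral [simp]: "f (numeral n) = numeral n"
  by (metis of_nat of_nat_numeral)

lemma eval_pCons: "poly (map_poly f (pCons a p)) c = f a + c * poly (map_poly f p) c"
  by (simp add: map_poly_pCons)

lemma map_poly_add: "map_poly f (p + q) = map_poly f p + map_poly f q"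
  by (simp add: poly_eq_iff coeff_map_poly add)

lemma comm_ring_map_eval: "comm_ring_map (\<lambda>p. poly (map_poly f p) c)"
proof
  show add': "poly (map_poly f (p + q)) c = poly (map_poly f p) c + poly (map_poly f q) c" for p q
    by (simp add: map_poly_add)
  have smult': "poly (map_poly f (smult a q)) c = f a * poly (map_poly f q) c" for a q
    by (subst map_poly_smult) (simp_all add: mult)
  show "poly (map_poly f (p * q)) c = poly (map_poly f p) c * poly (map_poly f q) c" for p q
    by (induction p) (simp_all add: add' smult' eval_pCons algebra_simps)
qed simp

end

lemma comm_ring_map_pcompose: "comm_ring_map (\<lambda>p. pcompose p q)"
  by standard (simp_all add: pcompose_add pcompose_mult pcompose_1)

section \<open>Plane curves whose level sets are parabolas\<close>

abbreviation dX :: "'a::field poly2 \<Rightarrow> 'a poly2" where "dX \<equiv> map_poly pderiv"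
abbreviation dY :: "'a::field poly2 \<Rightarrow> 'a poly2" where "dY \<equiv> pderiv"

interpretation dY: derivation "pderiv :: 'b::idom poly \<Rightarrow> 'b poly"
  by (rule derivation_pderiv)

interpretation dX: derivation "map_poly pderiv :: 'b::idom poly poly \<Rightarrow> 'b poly poly"
  by (rule dY.derivation_map_poly)

lemma dX_dY: "dX (dY p) = dY (dX p)"
  by (rule derivation.map_pderiv[OF derivation_pderiv])

section \<open>Points of the plane and restriction to curves\<close>

definition ev2 :: "'a::field poly2 \<Rightarrow> 'a \<Rightarrow> 'a \<Rightarrow> 'a" where
  "ev2 p x y = poly (poly p [:y:]) x"

lemma ev2_simps [simp]:
  "ev2 (p + q) x y = ev2 p x y + ev2 q x y"
  "ev2 (p - q) x y = ev2 p x y - ev2 q x y"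
  "ev2 (p * q) x y = ev2 p x y * ev2 q x y"
  "ev2 [:[:c:]:] x y = c"
  "ev2 [:0, 1:] x y = y"
  "ev2 (smult [:c:] p) x y = c * ev2 p x y"
  by (simp_all add: ev2_def)

text \<open>Characteristic 0 makes the field infinite. For each y the polynomial in x is zero, so a
  nonzero \<open>p\<close> would have infinitely many roots \<open>[:y:]\<close> in K[x].\<close>

lemma ev2_eq_0_imp:
  fixes p :: "'a::field_char_0 poly2"
  assumes "\<And>x y. ev2 p x y = 0"
  shows "p = 0"
proof -
  have 1: "poly p [:y:] = 0" for y
    using assms by (simp add: ev2_def flip: poly_all_0_iff_0)
  show ?thesis
  proof (rule ccontr)
    assume "p \<noteq> 0"
    then have "finite {z. poly p z = 0}" by (rule poly_roots_finite)
    moreover have "range (\<lambda>y::'a. [:y:]) \<subseteq> {z. poly p z = 0}" using 1 by auto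
    ultimately have "finite (range (\<lambda>y::'a. [:y:]))" by (rule rev_finite_subset)
    then have "finite (UNIV :: 'a set)" by (rule finite_imageD) (simp add: inj_on_def)
    then show False by (simp add: infinite_UNIV_char_0)
  qed
qed

text \<open>The pullback of \<open>p\<close> along the curve t -> (\<xi>(t), t), a graph over the
  y-axis.\<close>

definition restrict_curve :: "'a::field poly \<Rightarrow> 'a poly2 \<Rightarrow> 'a poly" where
  "restrict_curve \<xi> p = poly (map_poly (\<lambda>q. pcompose q \<xi>) p) [:0, 1:]"

lemma comm_ring_map_restrict_curve: "comm_ring_map (restrict_curve \<xi>)"
  unfolding restrict_curve_def
  by (rule comm_ring_map.comm_ring_map_eval[OF comm_ring_map_pcompose])

lemma restrict_curve_pCons:
  "restrict_curve \<xi> (pCons a p) = pcompose a \<xi> + [:0, 1:] * restrict_curve \<xi> p"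
  unfolding restrict_curve_def by (rule comm_ring_map.eval_pCons[OF comm_ring_map_pcompose])

lemma poly_restrict_curve: "poly (restrict_curve \<xi> p) t = ev2 p (poly \<xi> t) t"
proof (induction p)
  case 0
  then show ?case by (simp add: restrict_curve_def ev2_def)
next
  case (pCons a p)
  then show ?case by (simp add: restrict_curve_pCons ev2_def poly_pcompose)
qed

lemma pderiv_restrict_curve:
  "pderiv (restrict_curve \<xi> p)
     = restrict_curve \<xi> (dX p) * pderiv \<xi> + restrict_curve \<xi> (dY p)"
proof -
  interpret r: comm_ring_map "restrict_curve \<xi>" by (rule comm_ring_map_restrict_curve)
  show ?thesis
  proof (induction p)
    case 0
    then show ?case by simp
  next
    case (pCons a p)
    have "restrict_curve \<xi> (dY (pCons a p)) = restrict_curve \<xi> p + [:0, 1:] * restrict_curve \<xi> (dY p)"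
      by (simp only: pderiv_pCons r.add restrict_curve_pCons pcompose_0 add_0)
    moreover have "restrict_curve \<xi> (dX (pCons a p))
        = pcompose (pderiv a) \<xi> + [:0, 1:] * restrict_curve \<xi> (dX p)"
      by (simp only: derivation.map_pCons[OF derivation_pderiv] restrict_curve_pCons)
    moreover have "pderiv [:0, 1 :: 'a:] = 1" by (simp add: pderiv_pCons one_pCons)
    ultimately show ?case
      by (simp only: restrict_curve_pCons pderiv_add pderiv_mult pderiv_pcompose pCons.IH)
        (simp add: algebra_simps)
  qed
qed

text \<open>Orders of vanishing at \<open>y\<close>: if \<open>E\<close> and \<open>R\<close> are
  divisible by (t - y)^n, so are their derivatives, as \<open>W\<close> does not vanish at
  \<open>y\<close>. Both vanish at \<open>y\<close> and the characteristic is 0, so they are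
  divisible by (t - y)^(n+1). Only 0 is divisible by all powers.\<close>

lemma linear_ode_unique:
  fixes E R W :: "'a::field_char_0 poly"
  assumes W: "poly W y \<noteq> 0" and init: "poly E y = 0" "poly R y = 0"
    and E: "W * pderiv E = E * a + R * b" and R: "W * pderiv R = E * c + R * d"
  shows "E = 0" "R = 0"
proof -
  have step: "[:- y, 1:] ^ Suc n dvd F"
    if "[:- y, 1:] ^ n dvd W * pderiv F" "poly F y = 0" for n and F :: "'a poly"
  proof (cases "F = 0")
    case False
    have nz: "pderiv F \<noteq> 0"
    proof
      assume "pderiv F = 0"
      then obtain k where "F = [:k:]" by (metis degree_eq_zeroE pderiv_eq_0_iff)
      with False that(2) show False by simp
    qed
    moreover have "W \<noteq> 0" "order y W = 0" using W by (auto simp: order_0I)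
    ultimately have "n \<le> order y (pderiv F)"
      using that(1) by (simp add: order_divides order_mult)
    moreover have "order y F = Suc (order y (pderiv F))"
      using False nz that(2) by (intro order_pderiv) (auto simp: order_root)
    ultimately show ?thesis by (subst order_divides) simp
  qed simp
  have "[:- y, 1:] ^ n dvd E \<and> [:- y, 1:] ^ n dvd R" for n
  proof (induction n)
    case (Suc n)
    then have "[:- y, 1:] ^ n dvd W * pderiv E" "[:- y, 1:] ^ n dvd W * pderiv R"
      unfolding E R by auto
    then show ?case using step init by blast
  qed simp
  then show "E = 0" "R = 0"
    by (metis Suc_n_not_le_n order_divides)+
qed

text \<open>The first two equations say that the level sets of \<open>v\<close>, seen as graphs over the \<open>y\<close>-axis, have
  second derivative \<open>- M / (dX v)^3\<close> and that this quantity is constant along them. So a level set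
  and the parabola with the same 2-jet solve the same linear differential equation.\<close>

lemma level_set_parabola:
  fixes v M :: "'a::field_char_0 poly2"
  assumes M: "dY (dY v) * (dX v)\<^sup>2 - 2 * dX v * dY v * dY (dX v) + (dY v)\<^sup>2 * dX (dX v) = M"
    and M_inv: "dX v * (dY M * dX v - dX M * dY v) = 3 * M * (dY (dX v) * dX v - dX (dX v) * dY v)"
    and nz: "ev2 (dX v) (poly \<xi> y) y \<noteq> 0"
    and slope: "ev2 (dX v) (poly \<xi> y) y * poly (pderiv \<xi>) y = - ev2 (dY v) (poly \<xi> y) y"
    and curv: "c * ev2 (dX v) (poly \<xi> y) y ^ 3 = - ev2 M (poly \<xi> y) y"
    and \<xi>: "pderiv (pderiv \<xi>) = [:c:]"
  shows "restrict_curve \<xi> v = [:ev2 v (poly \<xi> y) y:]"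
proof -
  interpret r: comm_ring_map "restrict_curve \<xi>" by (rule comm_ring_map_restrict_curve)
  define w S m wx wy Sy mx my l
    where "w = restrict_curve \<xi> (dX v)" and "S = restrict_curve \<xi> (dY v)"
      and "m = restrict_curve \<xi> M" and "wx = restrict_curve \<xi> (dX (dX v))"
      and "wy = restrict_curve \<xi> (dY (dX v))" and "Sy = restrict_curve \<xi> (dY (dY v))"
      and "mx = restrict_curve \<xi> (dX M)" and "my = restrict_curve \<xi> (dY M)"
      and "l = pderiv \<xi>"
  note defs = w_def S_def m_def wx_def wy_def Sy_def mx_def my_def l_def
  define \<tau> where "\<tau> = [:c:]"
  \<comment> \<open>\<open>E\<close> is the derivative of v along the curve, \<open>R\<close> the
    defect in the curvature condition. The two identities for \<open>M\<close> make \<open>w\<close>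
    squared times each derivative a linear combination of \<open>E\<close> and
    \<open>R\<close>.\<close>
  define E R where "E = w * l + S" and "R = m + \<tau> * w ^ 3"
  have dw: "pderiv w = wx * l + wy" and dS: "pderiv S = wy * l + Sy" and dm: "pderiv m = mx * l + my"
    by (simp_all add: defs pderiv_restrict_curve dX_dY)
  have d\<tau>: "pderiv \<tau> = 0" and dl: "pderiv l = \<tau>" by (simp_all add: \<tau>_def l_def \<xi>)
  have m: "Sy * w\<^sup>2 - 2 * w * S * wy + S\<^sup>2 * wx = m"
    using arg_cong[OF M, of "restrict_curve \<xi>"] by (simp add: defs r.add r.diff r.mult r.power)
  have m_inv: "w * (my * w - mx * S) = 3 * m * (wy * w - wx * S)"
    using arg_cong[OF M_inv, of "restrict_curve \<xi>"] by (simp add: defs r.add r.diff r.mult r.power)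
  have "pderiv E = (wx * l + wy) * l + w * \<tau> + (wy * l + Sy)"
    by (simp add: E_def pderiv_add pderiv_mult dw dS dl algebra_simps)
  then have odeE: "w\<^sup>2 * pderiv E = E * (wx * E - 2 * wx * S + 2 * wy * w) + R * 1"
    using m unfolding E_def R_def by algebra
  have "pderiv R = mx * l + my + 3 * \<tau> * w\<^sup>2 * (wx * l + wy)"
    by (simp add: R_def pderiv_add pderiv_mult dw dm d\<tau> power3_eq_cube power2_eq_square algebra_simps)
  then have odeR: "w\<^sup>2 * pderiv R = E * (w * mx + 3 * \<tau> * w ^ 3 * wx) + R * (3 * (wy * w - wx * S))"
    using m_inv unfolding E_def R_def by algebra
  have "E = 0"
  proof (rule linear_ode_unique[OF _ _ _ odeE odeR])
    show "poly (w\<^sup>2) y \<noteq> 0" using nz by (simp add: w_def poly_restrict_curve)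
    show "poly E y = 0" using slope by (simp add: E_def defs poly_restrict_curve)
    show "poly R y = 0" using curv by (simp add: R_def \<tau>_def defs poly_restrict_curve)
  qed
  then have "pderiv (restrict_curve \<xi> v) = 0"
    by (simp add: pderiv_restrict_curve E_def defs)
  then obtain k where "restrict_curve \<xi> v = [:k:]"
    by (auto simp: pderiv_eq_0_iff elim: degree_eq_zeroE)
  moreover have "k = ev2 v (poly \<xi> y) y"
    using poly_restrict_curve[of \<xi> v y] calculation by simp
  ultimately show ?thesis by simp
qed

text \<open>The first identity is the x-derivative of \<open>eq\<close> with \<open>dY P\<close>
  eliminated through \<open>eq\<close> itself. For the second, \<open>vh\<close> makes h locally a
  function of v; then M / (dX v)^3 is the second derivative of h with respect to v, hence constant
  along level sets.\<close>

lemma curvature_of_level_sets: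
  fixes P v h :: "'a::field_char_0 poly2"
  assumes P: "dX P = dY v" and eq: "(dY v)\<^sup>2 + dX h = dX v * dY P"
    and vh: "dX v * dY h = dY v * dX h" and nz: "dX v \<noteq> 0"
  defines "M \<equiv> dX (dX h) * dX v - dX h * dX (dX v)"
  shows "dY (dY v) * (dX v)\<^sup>2 - 2 * dX v * dY v * dY (dX v) + (dY v)\<^sup>2 * dX (dX v) = M"
    and "dX v * (dY M * dX v - dX M * dY v) = 3 * M * (dY (dX v) * dX v - dX (dX v) * dY v)"
proof -
  define w S a b where "w = dX v" and "S = dY v" and "a = dX h" and "b = dY h"
  have Sx: "dX S = dY w" and bx: "dX b = dY a" and Pxy: "dX (dY P) = dY S"
    by (simp_all add: w_def S_def a_def b_def dX_dY P)
  have wb: "w * b = S * a" using vh by (simp add: w_def S_def a_def b_def)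
  have "dX (S\<^sup>2 + a) = dX (w * dY P)" using eq by (simp add: w_def S_def a_def)
  then have "2 * S * dY w + dX a = w * dY S + dY P * dX w"
    by (simp add: dX.add dX.mult dX.power2 Sx Pxy)
  moreover have "S\<^sup>2 + a = w * dY P" using eq by (simp add: w_def S_def a_def)
  ultimately have "dY S * w\<^sup>2 - 2 * w * S * dY w + S\<^sup>2 * dX w = dX a * w - a * dX w"
    by algebra
  then show "dY (dY v) * (dX v)\<^sup>2 - 2 * dX v * dY v * dY (dX v) + (dY v)\<^sup>2 * dX (dX v) = M"
    by (simp add: M_def w_def S_def a_def)
  \<comment> \<open>\<open>M\<close> and \<open>N\<close> are the numerators of the x- and
    y-derivatives of a / w, which is dh/dv; \<open>NM\<close> says that its gradient is proportional
    to that of v.\<close>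
  define N where "N = dY a * w - a * dY w"
  have M: "M = dX a * w - a * dX w" by (simp add: M_def w_def a_def)
  have "dX (w * b) = dX (S * a)" by (simp add: wb)
  then have "w * dY a + b * dX w = S * dX a + a * dY w"
    by (simp add: dX.mult bx Sx)
  then have NM: "N * w = M * S" unfolding N_def M using wb by algebra
  have "dX (N * w) = dX (M * S)" by (simp add: NM)
  then have d: "N * dX w + w * dX N = M * dY w + S * dX M"
    by (simp add: dX.mult Sx)
  have My: "dY M = dY (dX a) * w + dX a * dY w - dY a * dX w - a * dY (dX w)"
    unfolding M by (simp add: dY.diff dY.mult algebra_simps)
  have Nx: "dX N = dY (dX a) * w + dY a * dX w - dX a * dY w - a * dY (dX w)"
    unfolding N_def by (simp add: dX.diff dX.mult dX_dY algebra_simps)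
  have "w * (dY M - dX N) = 2 * (dY w * M - dX w * N)"
    unfolding My Nx unfolding M N_def by algebra
  then have "w * (dY M * w - dX M * S) = 3 * M * (dY w * w - dX w * S)"
    using d NM by algebra
  then show "dX v * (dY M * dX v - dX M * dY v) = 3 * M * (dY (dX v) * dX v - dX (dX v) * dY v)"
    by (simp add: w_def S_def)
qed

text \<open>The parabolas through points with different values of \<open>v\<close> are disjoint; over an algebraically
  closed field this forces them to be translates of each other.\<close>

lemma level_sets_translates:
  fixes P v h :: "'a::{alg_closed_field, field_char_0} poly2"
  assumes P: "dX P = dY v" and eq: "(dY v)\<^sup>2 + dX h = dX v * dY P"
    and vh: "dX v * dY h = dY v * dX h" and nz: "dX v \<noteq> 0"
  shows "\<exists>B C. dY v = - [:[:B:], [:2 * C:]:] * dX v"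
proof -
  define M where "M = dX (dX h) * dX v - dX h * dX (dX v)"
  note curv = curvature_of_level_sets[OF assms, folded M_def]
  define w S where "w = dX v" and "S = dY v"
  \<comment> \<open>Slope and second derivative of the level set through (x,y), as a graph over the
    y-axis; meaningful where \<open>ev2 w x y\<close> is nonzero.\<close>
  define \<sigma> \<tau> where "\<sigma> x y = - ev2 S x y / ev2 w x y" and "\<tau> x y = - ev2 M x y / ev2 w x y ^ 3"
    for x y
  \<comment> \<open>The parabola x + \<sigma>(t - y) + \<tau>(t - y)^2/2, expanded in powers of
    t.\<close>
  define \<xi> where "\<xi> x y = [:x - \<sigma> x y * y + \<tau> x y * y\<^sup>2 / 2, \<sigma> x y - \<tau> x y * y, \<tau> x y / 2:]" for x y
  have \<xi>_at: "poly (\<xi> x y) y = x" for x y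
    by (simp add: \<xi>_def power2_eq_square field_simps)
  have d\<xi>: "pderiv (\<xi> x y) = [:\<sigma> x y - \<tau> x y * y, \<tau> x y:]" for x y
    by (simp add: \<xi>_def pderiv_pCons)
  have level: "ev2 v (poly (\<xi> x y) t) t = ev2 v x y" if "ev2 w x y \<noteq> 0" for x y t
  proof -
    have "restrict_curve (\<xi> x y) v = [:ev2 v (poly (\<xi> x y) y) y:]"
    proof (rule level_set_parabola[OF curv])
      show "ev2 (dX v) (poly (\<xi> x y) y) y \<noteq> 0" using that by (simp add: \<xi>_at w_def)
      show "ev2 (dX v) (poly (\<xi> x y) y) y * poly (pderiv (\<xi> x y)) y = - ev2 (dY v) (poly (\<xi> x y) y) y"
        using that unfolding \<xi>_at d\<xi> by (simp add: \<sigma>_def w_def S_def)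
      show "\<tau> x y * ev2 (dX v) (poly (\<xi> x y) y) y ^ 3 = - ev2 M (poly (\<xi> x y) y) y"
        using that unfolding \<xi>_at by (simp add: \<tau>_def w_def)
      show "pderiv (pderiv (\<xi> x y)) = [:\<tau> x y:]"
        unfolding d\<xi> by (simp add: pderiv_pCons)
    qed
    then have "poly (restrict_curve (\<xi> x y) v) t = ev2 v x y" by (simp add: \<xi>_at)
    then show ?thesis by (simp add: poly_restrict_curve)
  qed
  obtain x0 y0 where p0: "ev2 w x0 y0 \<noteq> 0"
    using nz ev2_eq_0_imp unfolding w_def by blast
  define C where "C = \<tau> x0 y0 / 2"
  define B where "B = \<sigma> x0 y0 - \<tau> x0 y0 * y0"
  define v0 where "v0 = ev2 v x0 y0"
  have same: "\<tau> x y / 2 = C \<and> \<sigma> x y - \<tau> x y * y = B"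
    if "ev2 w x y \<noteq> 0" "ev2 v x y \<noteq> v0" for x y
  proof -
    have "poly (\<xi> x y - \<xi> x0 y0) t \<noteq> 0" for t
      using level[OF that(1), of t] level[OF p0, of t] that(2) by (auto simp: v0_def)
    then have "degree (\<xi> x y - \<xi> x0 y0) = 0"
      using alg_closed_imp_poly_has_root by blast
    then have "coeff (\<xi> x y - \<xi> x0 y0) 1 = 0" "coeff (\<xi> x y - \<xi> x0 y0) 2 = 0"
      by (intro coeff_eq_0; simp)+
    then show ?thesis by (simp add: \<xi>_def B_def C_def numeral_2_eq_2)
  qed
  \<comment> \<open>The two extra factors vanish at the points that \<open>same\<close> does not
    cover, so the product is zero everywhere; neither factor is the zero polynomial, so both
    cancel.\<close>
  have "ev2 (w * (v - [:[:v0:]:]) * (S + [:[:B:], [:2 * C:]:] * w)) x y = 0" for x y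
  proof (cases "ev2 w x y = 0 \<or> ev2 v x y = v0")
    case False
    then have "\<sigma> x y = B + 2 * C * y" using same[of x y] by (auto simp: field_simps)
    moreover have "- ev2 S x y = \<sigma> x y * ev2 w x y" using False by (simp add: \<sigma>_def)
    ultimately have "ev2 S x y = - (B + 2 * C * y) * ev2 w x y"
      by (metis minus_minus mult_minus_left)
    moreover have "ev2 [:[:B:], [:2 * C:]:] x y = B + 2 * C * y" by (simp add: ev2_def)
    ultimately show ?thesis by (simp only: ev2_simps mult_minus_left) simp
  qed auto
  then have "w * (v - [:[:v0:]:]) * (S + [:[:B:], [:2 * C:]:] * w) = 0"
    by (rule ev2_eq_0_imp)
  moreover have "v - [:[:v0:]:] \<noteq> 0"
  proof
    assume "v - [:[:v0:]:] = 0"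
    then have "v = [:[:v0:]:]" by simp
    then have "dX v = 0" by simp
    with nz show False by simp
  qed
  ultimately have "S + [:[:B:], [:2 * C:]:] * w = 0"
    using nz unfolding w_def by (metis mult_eq_0_iff)
  then have "dY v = - [:[:B:], [:2 * C:]:] * dX v"
    unfolding w_def S_def by (metis add_eq_0_iff2 mult_minus_left)
  then show ?thesis by blast
qed

lemma dX_dY_eq_0_imp_const:
  fixes p :: "'a::field_char_0 poly2"
  assumes "dX p = 0" "dY p = 0"
  obtains c where "p = [:[:c:]:]"
proof -
  obtain r where r: "p = [:r:]" using assms(2) by (metis degree_eq_zeroE pderiv_eq_0_iff)
  then have "pderiv r = 0" using assms(1) by simp
  then obtain c where "r = [:c:]" by (metis degree_eq_zeroE pderiv_eq_0_iff)
  with r that show thesis by simp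
qed

text \<open>With q = B + 2Cy, the polynomial p = P + qv is free of x, and \<open>eq\<close> and
  \<open>vh\<close> give h_x = v_x(p_y - 2Cv) and h_y = v_y(p_y - 2Cv). Equality of the mixed
  derivatives of h forces p_yy = 0, so p is affine in y and h can be integrated.\<close>

lemma potential_normal_form:
  fixes P v h :: "'a::{alg_closed_field, field_char_0} poly2"
  assumes P: "dX P = dY v" and eq: "(dY v)\<^sup>2 + dX h = dX v * dY P"
    and vh: "dX v * dY h = dY v * dX h" and nz: "dX v \<noteq> 0"
  obtains B C m c c' where "dY v = - [:[:B:], [:2 * C:]:] * dX v"
    and "P = [:[:c:], [:m:]:] - [:[:B:], [:2 * C:]:] * v"
    and "h = [:[:m:]:] * v - [:[:C:]:] * v\<^sup>2 + [:[:c':]:]"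
proof -
  obtain B C where BC: "dY v = - [:[:B:], [:2 * C:]:] * dX v"
    using level_sets_translates[OF assms] by blast
  define q and k :: "'a poly2" where "q = [:[:B:], [:2 * C:]:]" and "k = [:[:C:]:]"
  have v: "dY v = - q * dX v" using BC by (simp add: q_def)
  have q: "dX q = 0" "dY q = 2 * k" and k: "dX k = 0" "dY k = 0"
    by (simp_all add: q_def k_def pderiv_pCons numeral_poly)
  define p where "p = P + q * v"
  have px: "dX p = 0" by (simp add: p_def dX.add dX.mult q P v)
  have "dY P = dY (p - q * v)" by (simp add: p_def)
  then have Py: "dY P = dY p - 2 * k * v + q\<^sup>2 * dX v"
    by (simp add: dY.diff dY.mult q v power2_eq_square algebra_simps)
  have hx: "dX h = dX v * (dY p - 2 * k * v)"
    using eq unfolding Py v by algebra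
  have "dX v * (dY h + q * dX h) = 0" using vh v by algebra
  then have "dY h = - q * dX h" using nz by (simp add: eq_neg_iff_add_eq_0)
  then have hy: "dY h = dY v * (dY p - 2 * k * v)" by (simp add: v hx)
  have pxy: "dX (dY p) = 0" by (simp add: dX_dY px)
  have "dX (dY h) = dY (dX h)" by (rule dX_dY)
  then have "dX v * dY (dY p) = 0"
    unfolding hx hy by (simp add: dX.mult dX.diff dY.mult dY.diff k px dX_dY algebra_simps)
  then have pyy: "dY (dY p) = 0" using nz by simp
  obtain m where m: "dY p = [:[:m:]:]" using dX_dY_eq_0_imp_const[OF pxy pyy] .
  have "dX (p - [:0, [:m:]:]) = 0" "dY (p - [:0, [:m:]:]) = 0"
    by (simp_all add: dX.diff dY.diff px m pderiv_pCons)
  then obtain c where c: "p - [:0, [:m:]:] = [:[:c:]:]" by (rule dX_dY_eq_0_imp_const)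
  have "dX (h - ([:[:m:]:] * v - k * v\<^sup>2)) = 0" "dY (h - ([:[:m:]:] * v - k * v\<^sup>2)) = 0"
    unfolding dX.diff dY.diff hx hy dX.mult dY.mult dX.power2 dY.power2 k m
    by (simp_all add: algebra_simps)
  then obtain c' where c': "h - ([:[:m:]:] * v - k * v\<^sup>2) = [:[:c':]:]"
    by (rule dX_dY_eq_0_imp_const)
  show thesis
  proof (rule that[OF BC])
    have "p = [:[:c:]:] + [:0, [:m:]:]" using c by (metis diff_eq_eq)
    then have "p = [:[:c:], [:m:]:]" by simp
    then show "P = [:[:c:], [:m:]:] - [:[:B:], [:2 * C:]:] * v" by (simp add: p_def q_def algebra_simps)
    show "h = [:[:m:]:] * v - [:[:C:]:] * v\<^sup>2 + [:[:c':]:]" using c' by (simp add: k_def algebra_simps)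
  qed
qed

text \<open>The case \<open>h = 0\<close>: planar polynomial maps \<open>(- P, v)\<close> with nilpotent Jacobian.\<close>

lemma planar_nilpotent:
  fixes P v :: "'a::{alg_closed_field, field_char_0} poly2"
  assumes P: "dX P = dY v" and eq: "(dY v)\<^sup>2 = dX v * dY P"
  shows "(\<exists>c. v = [:[:c:]:]) \<or> (\<exists>s c. P = [:[:s:]:] * v + [:[:c:]:])"
proof (cases "dX v = 0")
  case True
  then have "dY v = 0" using eq by simp
  with True obtain c where "v = [:[:c:]:]" by (rule dX_dY_eq_0_imp_const)
  then show ?thesis by blast
next
  case nz: False
  have prem: "(dY v)\<^sup>2 + dX 0 = dX v * dY P" "dX v * dY 0 = dY v * dX 0"
    by (simp_all add: eq)
  obtain B C m c c' where BC: "P = [:[:c:], [:m:]:] - [:[:B:], [:2 * C:]:] * v"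
    and h: "0 = [:[:m:]:] * v - [:[:C:]:] * v\<^sup>2 + [:[:c':]:]"
    by (rule potential_normal_form[OF P prem nz])
  \<comment> \<open>Since v varies with x, the quadratic relation \<open>h\<close> must be trivial:
    two differentiations in x give C = 0, and then m = 0.\<close>
  have "dX ([:[:m:]:] * v - [:[:C:]:] * v\<^sup>2 + [:[:c':]:]) = dX 0"
    by (rule arg_cong[OF h[symmetric]])
  then have "dX v * ([:[:m:]:] - 2 * [:[:C:]:] * v) = 0"
    unfolding dX.diff dX.add dX.mult dX.power2 by (simp add: algebra_simps)
  then have 1: "[:[:m:]:] - 2 * [:[:C:]:] * v = 0" using nz by simp
  then have "dX ([:[:m:]:] - 2 * [:[:C:]:] * v) = 0" by simp
  then have "[:[:C:]:] * dX v = 0" unfolding dX.diff dX.mult by simp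
  then have "C = 0" using nz by simp
  moreover from this 1 have "m = 0" by simp
  ultimately have "P = [:[:- B:]:] * v + [:[:c:]:]" by (simp add: BC flip: smult_minus_left)
  then show ?thesis by blast
qed

section \<open>The transport equation solved by v\<close>

definition const2 :: "'a::field \<Rightarrow> 'a poly2" where "const2 c = [:[:c:]:]"

lemma comm_ring_map_const2: "comm_ring_map (const2 :: 'a::field \<Rightarrow> 'a poly2)"
  by standard (simp_all add: const2_def one_pCons)

lemma comm_ring_map_Const3: "comm_ring_map (Const3 :: 'a::field \<Rightarrow> 'a poly3)"
  by standard (simp_all add: Const3_def one_pCons)

lemma derivation_eval_const2:
  assumes "derivation D" "\<And>c. D (const2 c) = 0"
  shows "D (poly (map_poly const2 g) r) = poly (map_poly const2 (pderiv g)) r * D r"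
proof -
  interpret derivation D by fact
  interpret c: comm_ring_map const2 by (rule comm_ring_map_const2)
  interpret e: comm_ring_map "\<lambda>p. poly (map_poly const2 p) r" by (rule c.comm_ring_map_eval)
  show ?thesis
    by (induction g) (simp_all add: c.eval_pCons pderiv_pCons e.add add mult assms(2) algebra_simps)
qed

text \<open>Expand in powers of y: the equation expresses (m+1) times the coefficient of y^(m+1)
  through lower coefficients, which vanish by induction.\<close>

lemma transport_unique:
  fixes p :: "'a::field_char_0 poly2"
  assumes "dY p = q * dX p" "coeff p 0 = 0"
  shows "p = 0"
proof -
  have "coeff p n = 0" for n
  proof (induction n rule: less_induct)
    case (less n)
    show ?case
    proof (cases n)
      case (Suc m)
      have "of_nat (Suc m) * coeff p (Suc m) = (\<Sum>i\<le>m. coeff q i * pderiv (coeff p (m - i)))"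
        using arg_cong[OF assms(1), of "\<lambda>r. coeff r m"] by (simp add: coeff_pderiv coeff_mult)
      also have "\<dots> = 0" using less Suc by (intro sum.neutral) auto
      finally show ?thesis unfolding Suc by (simp del: of_nat_Suc)
    qed (use assms in simp)
  qed
  then show ?thesis by (simp add: poly_eq_iff)
qed

text \<open>Characteristics: x - By - Cy^2 solves the same equation and equals x at y = 0, so
  composing v(x,0) with it gives a solution with the initial values of v.\<close>

lemma transport_solution:
  fixes v :: "'a::field_char_0 poly2"
  assumes "dY v = - [:[:B:], [:2 * C:]:] * dX v"
  shows "v = poly (map_poly const2 (poly v 0)) [:[:0, 1:], [:- B:], [:- C:]:]" (is "_ = ?v")
proof -
  define r q where "r = [:[:0, 1:], [:- B:], [:- C:]:]" and "q = [:[:B:], [:2 * C:]:]"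
  have r: "dX r = 1" "dY r = - q"
    by (simp_all add: r_def q_def pderiv_pCons one_pCons)
  have "dX ?v = poly (map_poly const2 (pderiv (poly v 0))) r"
    "dY ?v = - poly (map_poly const2 (pderiv (poly v 0))) r * q"
    using derivation_eval_const2[OF dX.derivation_axioms, of "poly v 0" r]
      derivation_eval_const2[OF dY.derivation_axioms, of "poly v 0" r]
    by (simp_all add: const2_def r flip: r_def)
  moreover have "dY v = - q * dX v" using assms by (simp only: q_def)
  ultimately have eq: "dY (v - ?v) = - q * dX (v - ?v)"
    unfolding dX.diff dY.diff by (simp add: algebra_simps)
  have at0: "poly r 0 = [:0, 1:]" "poly (const2 c) 0 = [:c:]" for c :: 'a
    by (simp_all add: r_def const2_def)
  have "poly (poly (map_poly const2 g) r) 0 = g" for g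
    by (induction g) (simp_all add: comm_ring_map.eval_pCons[OF comm_ring_map_const2] at0)
  then have "coeff (v - ?v) 0 = 0" by (simp add: r_def flip: poly_0_coeff_0)
  with eq have "v - ?v = 0" by (rule transport_unique)
  then show ?thesis by simp
qed

section \<open>The second component is affine in its last variable\<close>

abbreviation dX3 :: "'a::field poly3 \<Rightarrow> 'a poly3" where "dX3 \<equiv> map_poly (map_poly pderiv)"
abbreviation dY3 :: "'a::field poly3 \<Rightarrow> 'a poly3" where "dY3 \<equiv> map_poly pderiv"
abbreviation dZ :: "'a::field poly3 \<Rightarrow> 'a poly3" where "dZ \<equiv> pderiv"

lemma degree_le_1_eq: "degree p \<le> 1 \<Longrightarrow> p = [:coeff p 0, coeff p 1:]"
  by (rule poly_eqI) (auto simp: coeff_pCons coeff_eq_0 split: nat.splits)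

lemma coeff_mult_add:
  assumes "degree p \<le> m" "degree q \<le> n"
  shows "coeff (p * q) (m + n) = coeff p m * coeff q n"
proof -
  have "coeff p i * coeff q (m + n - i) = 0" if "i \<in> {..m + n} - {m}" for i
    using that assms by (cases "i < m") (auto simp: coeff_eq_0)
  then have "(\<Sum>i\<le>m + n. coeff p i * coeff q (m + n - i)) = (\<Sum>i\<in>{m}. coeff p i * coeff q (m + n - i))"
    by (intro sum.mono_neutral_right) auto
  then show ?thesis by (simp add: coeff_mult)
qed

lemma degree_map_derivation_le:
  assumes "derivation D"
  shows "degree (map_poly D p) \<le> degree p"
  using assms by (intro degree_le) (simp add: derivation.coeff coeff_eq_0 derivation.zero)

text \<open>\<open>T\<close>, \<open>Q\<close> and \<open>par\<close> are the trace, minor and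
  determinant conditions after the chain rule. If v had degree at least 2 in t, then v_t(x,y,u)
  would have degree at least deg u in z; comparing degrees makes u_y and u_x free of z, which
  contradicts \<open>Q\<close>, \<open>par\<close> and \<open>uz\<close>.\<close>

lemma degree_le_1_nilpotent:
  fixes u v :: "'a::field_char_0 poly3" and h :: "'a poly2"
  assumes T: "dX3 u + pcompose (dY3 v) u + pcompose (pderiv v) u * dY3 u = 0"
    and Q: "dX3 u * pcompose (dY3 v) u - dY3 u * pcompose (dX3 v) u
              - dZ u * ([:dX h:] + pcompose (pderiv v) u * [:dY h:]) = 0"
    and par: "dX3 v * [:dY h:] = dY3 v * [:dX h:]"
    and uz: "dZ u \<noteq> 0" and h: "dX h \<noteq> 0 \<or> dY h \<noteq> 0"
  shows "degree v \<le> 1"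
proof (rule ccontr)
  assume "\<not> degree v \<le> 1"
  define s d r where "s = degree v" and "d = degree u" and "r = lead_coeff u"
  have s: "s \<ge> 2" using \<open>\<not> degree v \<le> 1\<close> by (simp add: s_def)
  have d: "d \<ge> 1" using uz by (simp add: d_def pderiv_eq_0_iff Suc_le_eq)
  have r: "r \<noteq> 0" "coeff u d = r" using d by (auto simp: r_def d_def)
  have "d < s * d" using s d by simp
  have deg_cv: "degree (pcompose p u) = degree p * d" for p by (simp add: degree_pcompose d_def)
  define Ux Uy V Vx Vy a b where "Ux = dX3 u" and "Uy = dY3 u" and "V = pcompose (pderiv v) u"
    and "Vx = pcompose (dX3 v) u" and "Vy = pcompose (dY3 v) u" and "a = [:dX h:]" and "b = [:dY h:]"
  have T': "Ux + Vy + V * Uy = 0" using T by (simp add: Ux_def Uy_def V_def Vy_def)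
  have Q': "Ux * Vy - Uy * Vx - dZ u * (a + V * b) = 0"
    using Q by (simp add: Ux_def Uy_def V_def Vx_def Vy_def a_def b_def)
  have par': "Vx * b = Vy * a"
    using arg_cong[OF par, of "\<lambda>p. pcompose p u"]
    by (simp only: pcompose_mult pcompose_const Vx_def Vy_def a_def b_def)

  \<comment> \<open>\<open>T\<close> reads u_x + (v(x,y,u))_y = 0; as d < s * d, its coefficient of
    z^(s * d) comes from the second term alone.\<close>
  have "coeff (dX3 u + dY3 (pcompose v u)) (s * d) = 0"
    using T by (simp only: dY.map_pcompose add.assoc coeff_0)
  then have "dY (coeff (pcompose v u) (s * d)) = 0"
    using \<open>d < s * d\<close> by (simp add: coeff_eq_0 d_def)
  moreover have "coeff (pcompose v u) (s * d) = lead_coeff v * r ^ s"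
    using d by (simp add: s_def d_def r_def lead_coeff_comp flip: degree_pcompose)
  ultimately have "degree (lead_coeff v * r ^ s) = 0" by (simp add: pderiv_eq_0_iff)
  moreover have "lead_coeff v \<noteq> 0" using s by (auto simp: s_def)
  ultimately have "degree (lead_coeff v) = 0" "degree r = 0"
    using r s by (simp_all add: degree_mult_eq degree_power_eq)
  then have vs: "dY (lead_coeff v) = 0" and "\<exists>r0. r = [:r0:]"
    by (auto simp: pderiv_eq_0_iff elim: degree_eq_zeroE)
  then obtain r0 where r0: "r = [:r0:]" by blast

  have "coeff (dY3 v) i = 0" if "i > s - 1" for i
    using that vs by (cases "i = s") (auto simp: s_def coeff_eq_0)
  then have deg_vy: "degree (dY3 v) \<le> s - 1" by (intro degree_le) simp
  have degV: "degree V = (s - 1) * d" by (simp add: V_def deg_cv degree_pderiv s_def)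
  have "(s - 1) * d \<ge> d" using s d by simp
  have degUx: "degree Ux \<le> d" unfolding Ux_def d_def
    by (rule degree_map_derivation_le) (rule dX.derivation_axioms)
  have "V \<noteq> 0" using degV d s by auto
  have "degree Uy = 0"
  proof (cases "Uy = 0")
    case False
    have "V * Uy = - (Ux + Vy)" using T' by (simp add: eq_neg_iff_add_eq_0 algebra_simps)
    then have "(s - 1) * d + degree Uy = degree (Ux + Vy)"
      using False \<open>V \<noteq> 0\<close> by (metis degV degree_minus degree_mult_eq)
    also have "\<dots> \<le> (s - 1) * d"
    proof (rule degree_add_le)
      show "degree Ux \<le> (s - 1) * d" using degUx \<open>(s - 1) * d \<ge> d\<close> by (rule order_trans)
      show "degree Vy \<le> (s - 1) * d" unfolding Vy_def deg_cv using deg_vy by (rule mult_le_mono1)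
    qed
    finally show ?thesis by simp
  qed simp
  then obtain uy where uy: "Uy = [:uy:]" by (rule degree_eq_zeroE)

  \<comment> \<open>\<open>w\<close> is chosen so that w(x,y,u) = - u_x. Composition with
    \<open>u\<close> multiplies degrees by \<open>d\<close>, so \<open>w\<close> is at most linear
    in t.\<close>
  define w where "w = dY3 v + [:uy:] * pderiv v"
  have cw: "pcompose w u = - Ux"
  proof -
    have "pcompose w u = Vy + Uy * V"
      by (simp only: w_def uy pcompose_add pcompose_mult pcompose_const Vy_def V_def)
    then show ?thesis using T' by algebra
  qed
  then have "degree w * d \<le> d" using degUx by (metis deg_cv degree_minus)
  then have "degree w \<le> 1" using d by simp
  then obtain w0 w1 where w: "w = [:w0, w1:]" using degree_le_1_eq by blast
  have "coeff (pcompose w u) d = r * w1"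
    using d by (simp add: w pcompose_pCons r coeff_pCons split: nat.split)
  moreover have "coeff (- Ux) d = [:- pderiv r0:]" by (simp add: Ux_def r r0)
  ultimately have rw: "[:r0:] * w1 = [:- pderiv r0:]" using cw r0 by metis
  have "r0 * coeff w1 0 = - pderiv r0" using arg_cong[OF rw, of "\<lambda>p. coeff p 0"] by simp
  \<comment> \<open>A polynomial dividing its own derivative, which has smaller degree unless it is
    zero, is constant in characteristic 0.\<close>
  then have "r0 dvd pderiv r0" by (metis dvd_minus_iff dvd_triv_left)
  then have "pderiv r0 = 0" by (simp add: pderiv_eq_0_iff)
  then have "w1 = 0" using rw r r0 by auto
  then have "Ux = [:- w0:]" using cw w 
    by (metis minus_minus minus_pCons minus_zero pCons_0_0 pcompose_const)
  then obtain ux where ux: "Ux = [:ux:]" by blast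

  define J where "J = Ux * b - Uy * a"
  \<comment> \<open>\<open>J\<close> is the Jacobian determinant of u and h in x, y. Multiply
    \<open>Q'\<close> by \<open>b\<close> and eliminate \<open>Vx\<close> by \<open>par'\<close> and
    \<open>Vy\<close> by \<open>T'\<close>.\<close>
  have "J * (Ux + V * Uy) + dZ u * b * (a + V * b) = 0"
    using T' Q' par' unfolding J_def by algebra
  then have VJ: "V * (Uy * J + dZ u * b\<^sup>2) = - (Ux * J + dZ u * b * a)" by algebra
  have F1: "Uy * J + dZ u * b\<^sup>2 = 0"
  proof (rule ccontr)
    assume "Uy * J + dZ u * b\<^sup>2 \<noteq> 0"
    then have "degree (V * (Uy * J + dZ u * b\<^sup>2)) \<ge> (s - 1) * d"
      using \<open>V \<noteq> 0\<close> by (simp add: degree_mult_eq degV)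
    moreover have "degree (Ux * J + dZ u * b * a) \<le> d - 1"
    proof (rule degree_add_le)
      show "degree (Ux * J) \<le> d - 1" by (simp add: J_def ux uy a_def b_def)
      have "degree (dZ u * b * a) \<le> degree (dZ u * b) + degree a" by (rule degree_mult_le)
      moreover have "degree (dZ u * b) \<le> degree (dZ u) + degree b" by (rule degree_mult_le)
      moreover have "degree a = 0" "degree b = 0" by (simp_all add: a_def b_def)
      moreover have "degree (dZ u) = d - 1" by (simp add: degree_pderiv d_def)
      ultimately show "degree (dZ u * b * a) \<le> d - 1" by linarith
    qed
    ultimately show False
      unfolding VJ degree_minus using \<open>(s - 1) * d \<ge> d\<close> d by linarith
  qed
  then have F2: "Ux * J + dZ u * b * a = 0" using VJ by algebra
  \<comment> \<open>\<open>a\<close> times \<open>F1\<close> minus \<open>b\<close> times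
    \<open>F2\<close> is - J^2.\<close>
  have "J * J = 0" using F1 F2 unfolding J_def by algebra
  then have "J = 0" by simp
  then have "b = 0" using F1 uz by simp
  then have "a \<noteq> 0" using h by (simp add: a_def b_def)
  then have "Vy = 0" using par' \<open>b = 0\<close> by simp
  then have "V * Uy = - Ux" using T' by (simp add: eq_neg_iff_add_eq_0 algebra_simps)
  moreover have "Uy \<noteq> 0" using Q' \<open>Vy = 0\<close> \<open>b = 0\<close> \<open>a \<noteq> 0\<close> uz by auto
  ultimately have "degree (- Ux) \<ge> (s - 1) * d"
    using \<open>V \<noteq> 0\<close> by (metis degV degree_mult_eq le_add1)
  then show False using \<open>(s - 1) * d \<ge> d\<close> d by (simp add: ux)
qed

text \<open>If h_y = 0, degrees in z settle the claim. Otherwise, with r the leading coefficient of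
  u in z, top coefficients show that a nonzero v1_y would make (r, v1 r) a planar map with nilpotent
  Jacobian; \<open>planar_nilpotent\<close> then gives a linear relation, which degrees in y
  refute.\<close>

lemma linear_coeff_const_nilpotent:
  fixes u :: "'a::{alg_closed_field, field_char_0} poly3" and h v0 v1 :: "'a poly2"
  defines "v \<equiv> [:v0, v1:]"
  assumes T: "dX3 u + pcompose (dY3 v) u + pcompose (pderiv v) u * dY3 u = 0"
    and Q: "dX3 u * pcompose (dY3 v) u - dY3 u * pcompose (dX3 v) u
              - dZ u * ([:dX h:] + pcompose (pderiv v) u * [:dY h:]) = 0"
    and par: "dX3 v * [:dY h:] = dY3 v * [:dX h:]"
    and uz: "dZ u \<noteq> 0" and h: "dX h \<noteq> 0 \<or> dY h \<noteq> 0"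
  shows "dX v1 = 0 \<and> dY v1 = 0"
proof -
  define d r where "d = degree u" and "r = lead_coeff u"
  have d: "d \<ge> 1" using uz by (simp add: d_def pderiv_eq_0_iff Suc_le_eq)
  have r: "r \<noteq> 0" "coeff u d = r" using d by (auto simp: r_def d_def)
  define Ux Uy V Vx Vy a b where "Ux = dX3 u" and "Uy = dY3 u" and "V = [:v1:]"
    and "Vx = [:dX v0:] + u * [:dX v1:]" and "Vy = [:dY v0:] + u * [:dY v1:]"
    and "a = [:dX h:]" and "b = [:dY h:]"
  have cv: "pcompose (pderiv v) u = V" "pcompose (dX3 v) u = Vx" "pcompose (dY3 v) u = Vy"
    by (simp_all add: v_def V_def Vx_def Vy_def pderiv_pCons pcompose_pCons)
  have T': "Ux + Vy + V * Uy = 0" using T unfolding cv by (simp add: Ux_def Uy_def)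
  have Q': "Ux * Vy - Uy * Vx - dZ u * (a + V * b) = 0"
    using Q unfolding cv by (simp add: Ux_def Uy_def a_def b_def)
  have par0: "dX v0 * dY h = dY v0 * dX h" and par1: "dX v1 * dY h = dY v1 * dX h"
    using par by (simp_all add: v_def mult.commute)
  then have par': "Vx * b = Vy * a" by (simp add: Vx_def Vy_def a_def b_def algebra_simps)
  show ?thesis
  proof (cases "dY h = 0")
    case True
    then have a: "a \<noteq> 0" "b = 0" using h by (simp_all add: a_def b_def)
    have v0y: "dY v0 = 0" and v1y: "dY v1 = 0" using par0 par1 True h by auto
    then have "Vy = 0" by (simp add: Vy_def)
    then have "Uy * Vx = - (dZ u * a)" using Q' a(2) \<open>Vy = 0\<close> by algebra
    moreover have "dZ u * a \<noteq> 0" using uz a by simp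
    moreover have "degree (- (dZ u * a)) = d - 1"
      using uz a by (simp add: degree_mult_eq degree_pderiv d_def) (simp add: a_def)
    ultimately have "degree Vx \<le> d - 1"
      by (metis degree_mult_eq le_add2 mult_eq_0_iff neg_equal_0_iff_equal)
    then have "coeff Vx d = 0" using d by (intro coeff_eq_0) simp
    then have "r * dX v1 = 0"
      using d by (simp add: Vx_def r coeff_pCons mult.commute split: nat.splits)
    with v1y r show ?thesis by simp
  next
    case hy: False
    show ?thesis
    proof (cases "dY v1 = 0")
      case True
      then show ?thesis using par1 hy by simp
    next
      case v1y: False
      have "dX3 u + dY3 (pcompose v u) = 0" using T by (simp only: dY.map_pcompose add.assoc)
      then have "coeff (dX3 u + dY3 (pcompose v u)) d = 0" by simp
      moreover have "coeff (pcompose v u) d = v1 * r"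
        using d by (simp add: v_def pcompose_pCons r coeff_pCons mult.commute split: nat.split)
      ultimately have t: "dX r + dY (v1 * r) = 0" by (simp add: r)
      then have t': "dX r + v1 * dY r + dY v1 * r = 0" by (simp add: dY.mult algebra_simps)
      \<comment> \<open>\<open>Ux\<close> and \<open>Vx\<close> are eliminated so that the
        coefficient of z^(2d) involves only r, v1 and h.\<close>
      have quad: "b * (Vy * Vy) + (a + V * b) * (Uy * Vy + dZ u * b) = 0"
        using T' Q' par' by algebra
      have deg: "degree Vy \<le> d" "degree Uy \<le> d" "degree (dZ u) < d"
      proof -
        show "degree Vy \<le> d" unfolding Vy_def by (intro degree_add_le) (auto simp: d_def)
        show "degree Uy \<le> d" unfolding Uy_def d_def
          by (rule degree_map_derivation_le) (rule dY.derivation_axioms)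
        show "degree (dZ u) < d" using d by (simp add: degree_pderiv d_def)
      qed
      have cVy: "coeff Vy d = r * dY v1"
        using d by (simp add: Vy_def r coeff_pCons mult.commute split: nat.split)
      have cUy: "coeff Uy d = dY r" by (simp add: Uy_def r)
      have "coeff (dZ u) (d + d) = 0" using deg(3) by (simp add: coeff_eq_0)
      then have "dY h * (r * dY v1 * (r * dY v1)) + (dX h + v1 * dY h) * (dY r * (r * dY v1)) = 0"
        using arg_cong[OF quad, of "\<lambda>p. coeff p (d + d)"] deg
        by (simp add: a_def b_def V_def coeff_mult_add cVy cUy mult.commute)
      then have "(r * dY v1) * (dY h * (r * dY v1) + (dX h + v1 * dY h) * dY r) = 0" by algebra
      then have "dY h * (r * dY v1) + (dX h + v1 * dY h) * dY r = 0" using r v1y by simp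
      then have hr: "dX h * dY r = dY h * dX r" using t' by algebra
      define G where "G = v1 * r"
      have "dY h * ((dY G)\<^sup>2 - dX G * dY (- r)) = 0"
        using t' hr par1 unfolding G_def dX.mult dY.mult dY.minus by algebra
      then have "(dY G)\<^sup>2 = dX G * dY (- r)" using hy by simp
      moreover have "dX (- r) = dY G" 
        using t unfolding G_def dX.minus by (rule minus_unique)
      ultimately consider c where "G = [:[:c:]:]" | s c where "- r = [:[:s:]:] * G + [:[:c:]:]"
        using planar_nilpotent by blast
      then show ?thesis
      proof cases
        case 1
        then have "degree (v1 * r) = 0" by (simp add: G_def)
        moreover have "v1 \<noteq> 0" using v1y by auto
        ultimately have "degree v1 = 0" using r by (simp add: degree_mult_eq)
        with v1y show ?thesis by (simp add: pderiv_eq_0_iff)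
      next
        case 2
        show ?thesis
        proof (cases "s = 0")
          case True
          with 2 have "r = - [:[:c:]:]" by (metis minus_minus add_0 mult_zero_left pCons_0_0)
          then have "dX r = 0" "dY r = 0" by simp_all
          with t' r v1y show ?thesis by simp
        next
          case False
          \<comment> \<open>The linear relation factors; the second factor has positive degree in y
            while the product is constant.\<close>
          have "r * ([:[:s:]:] * v1 + 1) = - [:[:c:]:]" using 2 unfolding G_def by algebra
          then have "degree (r * ([:[:s:]:] * v1 + 1)) = 0" by simp
          moreover have "degree v1 > 0" using v1y by (simp add: pderiv_eq_0_iff)
          then have "degree ([:[:s:]:] * v1 + 1) = degree v1"
            using False by (subst degree_add_eq_left) simp_all
          moreover from this \<open>degree v1 > 0\<close> have "[:[:s:]:] * v1 + 1 \<noteq> 0" by (metis degree_0 less_irrefl)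
          ultimately show ?thesis using \<open>degree v1 > 0\<close> r by (simp add: degree_mult_eq)
        qed
      qed
    qed
  qed
qed

text \<open>Both equations are read coefficientwise in z. The coefficient of z^d makes the leading
  coefficient of u constant; if d > 1, that of z^(d-1) makes h an affine function of v, which is
  excluded.\<close>

lemma linear_in_z_nilpotent:
  fixes u :: "'a::field_char_0 poly3" and v h :: "'a poly2"
  assumes T: "dX3 u + [:dY v:] = 0"
    and Q: "dX3 u * [:dY v:] - dY3 u * [:dX v:] - dZ u * [:dX h:] = 0"
    and par: "dX v * dY h = dY v * dX h"
    and uz: "dZ u \<noteq> 0" and v: "\<And>c. v \<noteq> [:[:c:]:]"
    and h: "\<And>k c. h \<noteq> [:[:k:]:] * v + [:[:c:]:]"
  obtains P u1 where "u = [:- P, [:[:u1:]:]:]" "u1 \<noteq> 0" "dX P = dY v"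
    "(dY v)\<^sup>2 + dX ([:[:u1:]:] * h) = dX v * dY P" "dX v \<noteq> 0"
proof -
  define d r where "d = degree u" and "r = lead_coeff u"
  have d: "d \<ge> 1" using uz by (simp add: d_def pderiv_eq_0_iff Suc_le_eq)
  have r: "r \<noteq> 0" "coeff u d = r" using d by (auto simp: r_def d_def)
  have E: "[:dY v:]\<^sup>2 + dY3 u * [:dX v:] + dZ u * [:dX h:] = 0" using T Q by algebra
  have vx: "dX v \<noteq> 0"
  proof
    assume 0: "dX v = 0"
    then have "dY v \<noteq> 0" using v dX_dY_eq_0_imp_const by metis
    moreover from this have "dX h = 0" using par 0 by simp
    ultimately show False using E 0 by simp
  qed
  have Ei: "(if i = 0 then (dY v)\<^sup>2 else 0) + dX v * dY (coeff u i)
      + of_nat (Suc i) * coeff u (Suc i) * dX h = 0" for i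
    using arg_cong[OF E, of "\<lambda>p. coeff p i"]
    by (auto simp: coeff_pderiv coeff_pCons power2_eq_square mult_ac simp del: of_nat_Suc split: nat.splits)
  have Ti: "dX (coeff u i) + (if i = 0 then dY v else 0) = 0" for i
    using arg_cong[OF T, of "\<lambda>p. coeff p i"] by (auto simp: coeff_pCons split: nat.splits)
  have "coeff u (Suc d) = 0" by (simp add: d_def coeff_eq_0)
  then have "dX r = 0" "dY r = 0" using Ei[of d] Ti[of d] d vx by (simp_all add: r)
  then obtain u1 where u1: "r = [:[:u1:]:]" by (rule dX_dY_eq_0_imp_const)
  then have "u1 \<noteq> 0" using r by auto
  have "d = 1"
  proof (rule ccontr)
    assume "d \<noteq> 1"
    then obtain i where i: "d = Suc i" "i \<noteq> 0" using d by (cases d) auto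
    define n :: 'a where "n = of_nat d"
    have n: "n \<noteq> 0" "of_nat d = [:[:n:]:]" using d by (simp_all add: n_def of_nat_poly)
    \<comment> \<open>\<open>k\<close> is the ratio h_x / v_x obtained by solving the coefficient of
      z^(d-1) in \<open>E\<close>; it is free of x because \<open>e\<close> is.\<close>
    define e k where "e = coeff u i" and "k = [:[:- inverse (n * u1):]:] * dY e"
    have ex: "dX e = 0" using Ti[of i] i by (simp add: e_def)
    have "[:[:- inverse (n * u1):]:] * ([:[:n:]:] * r) = - 1"
      using \<open>u1 \<noteq> 0\<close> n by (simp add: u1 one_pCons field_simps)
    moreover have "dX v * dY e + [:[:n:]:] * r * dX h = 0"
      using Ei[of i, folded i(1)] i(2) by (simp add: e_def r n(2))
    ultimately have hx: "dX h = k * dX v" unfolding k_def by algebra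
    have kx: "dX k = 0" by (simp add: k_def dX.mult dX_dY ex del: mult_pCons_left mult_pCons_right)
    have "dX v * (dY h - k * dY v) = 0" using par hx by algebra
    then have hy: "dY h = k * dY v" using vx by simp
    have "dX (dY h) = dY (dX h)" by (rule dX_dY)
    then have "dY k * dX v = 0" unfolding hx hy by (auto simp: dX.mult dY.mult kx dX_dY)
    then have "dY k = 0" using vx by simp
    with kx obtain \<kappa> where \<kappa>: "k = [:[:\<kappa>:]:]" by (rule dX_dY_eq_0_imp_const)
    have "dX (h - k * v) = 0" "dY (h - k * v) = 0"
      using kx \<open>dY k = 0\<close> by (simp_all add: dX.diff dY.diff dX.mult dY.mult hx hy)
    then obtain c where "h - k * v = [:[:c:]:]" by (rule dX_dY_eq_0_imp_const)
    then have "h = [:[:\<kappa>:]:] * v + [:[:c:]:]" unfolding \<kappa> by (metis diff_eq_eq add.commute)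
    with h show False by blast
  qed
  define P where "P = - coeff u 0"
  have "u = [:- P, [:[:u1:]:]:]"
  proof (rule poly_eqI)
    fix n
    show "coeff u n = coeff [:- P, [:[:u1:]:]:] n"
      using r u1 \<open>d = 1\<close> by (auto simp: P_def coeff_pCons d_def coeff_eq_0 split: nat.splits)
  qed
  moreover have Px: "dX P = dY v"
    using Ti[of 0] unfolding P_def dX.minus by (intro minus_unique) simp
  moreover have "(dY v)\<^sup>2 + dX v * dY (coeff u 0) + r * dX h = 0"
    using Ei[of 0] r \<open>d = 1\<close> by simp
  then have "(dY v)\<^sup>2 + r * dX h = dX v * dY P"
    unfolding P_def dY.minus by algebra
  then have "(dY v)\<^sup>2 + dX ([:[:u1:]:] * h) = dX v * dY P"
    by (simp add: dX.mult u1 del: mult_pCons_left mult_pCons_right)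
  ultimately show thesis using that \<open>u1 \<noteq> 0\<close> vx by blast
qed

section \<open>Shears\<close>

definition shear :: "'a::field \<Rightarrow> 'a poly2 \<Rightarrow> 'a poly2" where
  "shear c p = pcompose p [:[:0, c:], 1:]"

lemma comm_ring_map_shear: "comm_ring_map (shear c)"
  unfolding shear_def by (rule comm_ring_map_pcompose)

interpretation shear: comm_ring_map "shear c"
  by (rule comm_ring_map_shear)

lemma shear_const [simp]: "shear c [:a:] = [:a:]"
  by (simp add: shear_def)

lemma shear_shear_minus [simp]: "shear (- c) (shear c p) = p"
  by (simp add: shear_def flip: pcompose_assoc) (simp add: pcompose_pCons)

lemma ev2_shear_0: "ev2 (shear c p) 0 0 = ev2 p 0 0"
  by (induction p) (simp_all add: ev2_def shear_def pcompose_pCons)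

lemma dX_shear: "dX (shear c p) = shear c (dX p) + [:[:c:]:] * shear c (dY p)"
  unfolding shear_def dY.map_pcompose by (simp add: pderiv_pCons one_pCons mult.commute)

lemma dY_shear: "dY (shear c p) = shear c (dY p)"
  by (simp add: shear_def pderiv_pcompose pderiv_pCons)

lemma (in comm_ring_map) comm_ring_map_map_poly: "comm_ring_map (map_poly f)"
proof
  have sum: "f (sum g A) = (\<Sum>i\<in>A. f (g i))" for g :: "nat \<Rightarrow> 'b" and A
    by (induction A rule: infinite_finite_induct) (simp_all add: add)
  show "map_poly f (p * q) = map_poly f p * map_poly f q" for p q
    by (simp add: poly_eq_iff coeff_map_poly coeff_mult sum mult)
qed (simp_all add: map_poly_add)

interpretation shear3: comm_ring_map "map_poly (shear c)"
  by (rule shear.comm_ring_map_map_poly)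

lemma dX3_shear: "dX3 (map_poly (shear c) p) = map_poly (shear c) (dX3 p) + [:[:[:c:]:]:] * map_poly (shear c) (dY3 p)"
  by (simp add: poly_eq_iff coeff_map_poly dX_shear)

lemma dY3_shear: "dY3 (map_poly (shear c) p) = map_poly (shear c) (dY3 p)"
  by (simp add: poly_eq_iff coeff_map_poly dY_shear)

lemma dZ_shear: "dZ (map_poly (shear c) p) = map_poly (shear c) (dZ p)"
  by (simp add: poly_eq_iff coeff_map_poly coeff_pderiv shear.mult del: of_nat_Suc)

lemma shear_const3 [simp]: "map_poly (shear c) [:p:] = [:shear c p:]"
  by (simp add: map_poly_pCons)

text \<open>By \<open>dX_shear\<close>, the x-derivative after the shear is the shear of the
  operator d/dx + c d/dy. This absorbs the terms with \<open>C\<close>, while Jacobian determinants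
  in x, y are unchanged.\<close>

lemma shear_nilpotent:
  fixes u :: "'a::field poly3" and v h :: "'a poly2" and c :: 'a
  defines "C \<equiv> [:[:[:c:]:]:]"
  assumes T: "dX3 u + [:dY v:] + C * dY3 u = 0"
    and Q: "dX3 u * [:dY v:] - dY3 u * [:dX v:] - dZ u * ([:dX h:] + C * [:dY h:]) = 0"
    and par: "dX v * dY h = dY v * dX h"
  defines "u' \<equiv> map_poly (shear c) u" and "v' \<equiv> shear c v" and "h' \<equiv> shear c h"
  shows "dX3 u' + [:dY v':] = 0"
    and "dX3 u' * [:dY v':] - dY3 u' * [:dX v':] - dZ u' * [:dX h':] = 0"
    and "dX v' * dY h' = dY v' * dX h'"
proof -
  define s where "s = (map_poly (shear c) :: 'a poly3 \<Rightarrow> _)"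
  have sC: "s C = C" and s2: "s [:p:] = [:shear c p:]" for p by (simp_all add: s_def C_def)
  have add: "[:p + [:[:c:]:] * q:] = [:p:] + C * [:q:]" for p q by (simp add: C_def)
  note rules = dX3_shear[of c, folded s_def C_def] dY3_shear[of c, folded s_def]
    dZ_shear[of c, folded s_def]
    dX_shear dY_shear add
  have "s (dX3 u + [:dY v:] + C * dY3 u) = s 0" by (simp only: T)
  then show "dX3 u' + [:dY v':] = 0"
    unfolding u'_def v'_def s_def[symmetric] unfolding rules
    unfolding s_def shear3.add shear3.mult shear3.zero unfolding s_def[symmetric] s2 sC
    by (simp add: ac_simps)
  have "s (dX3 u * [:dY v:] - dY3 u * [:dX v:] - dZ u * ([:dX h:] + C * [:dY h:])) = s 0"
    by (simp only: Q)
  then show "dX3 u' * [:dY v':] - dY3 u' * [:dX v':] - dZ u' * [:dX h':] = 0"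
    unfolding u'_def v'_def h'_def s_def[symmetric] unfolding rules
    unfolding s_def shear3.add shear3.diff shear3.mult shear3.zero unfolding s_def[symmetric] s2 sC
    by algebra
  have "shear c (dX v * dY h) = shear c (dY v * dX h)" by (simp only: par)
  then show "dX v' * dY h' = dY v' * dX h'"
    unfolding v'_def h'_def dX_shear dY_shear shear.mult by algebra
qed

section \<open>Conjugation by a shear\<close>

lemma vec3_eq_iff: "F = vector [a, b, c] \<longleftrightarrow> F $ 1 = a \<and> F $ 2 = b \<and> F $ 3 = c"
  for F :: "'b::zero ^ 3"
  by (auto simp: vec_eq_iff forall_3)

lemma matrix_inv_eqI:
  fixes A B :: "'a::semiring_1 ^ 'n ^ 'n"
  assumes "A ** B = mat 1" "B ** A = mat 1"
  shows "matrix_inv A = B"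
proof -
  have "\<exists>B. A ** B = mat 1 \<and> B ** A = mat 1" using assms by blast
  then have "matrix_inv A ** A = mat 1" unfolding matrix_inv_def by (rule someI2_ex) blast
  then show ?thesis by (metis assms(1) matrix_mul_assoc matrix_mul_lid matrix_mul_rid)
qed

interpretation Const3: comm_ring_map Const3
  by (rule comm_ring_map_Const3)

lemma comm_ring_map_subst3: "comm_ring_map (\<lambda>p. subst3 p G)"
  unfolding subst3_def subst1_def
  by (intro comm_ring_map.comm_ring_map_eval comm_ring_map_Const3)

lemma subst1_pCons: "subst1 (pCons a p) q = Const3 a + q * subst1 p q"
  unfolding subst1_def by (rule comm_ring_map.eval_pCons[OF comm_ring_map_Const3])

lemma subst1_0 [simp]: "subst1 0 q = 0"
  by (simp add: subst1_def)

lemma subst1_1 [simp]: "subst1 1 q = 1"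
  by (simp add: subst1_def)

lemma subst3_simps:
  "subst3 (Const3 c) G = Const3 c" "subst3 X3 G = G $ 1" "subst3 Y3 G = G $ 2" "subst3 Z3 G = G $ 3"
proof -
  show "subst3 (Const3 c) G = Const3 c"
    unfolding Const3_def[of c] by (simp add: subst3_def map_poly_pCons subst1_pCons) (simp add: Const3_def)
qed (simp_all add: subst3_def map_poly_pCons subst1_pCons)

lemma subst3_pm_linear:
  "subst3 (pm_linear M $ i) G = Const3 (M $ i $ 1) * G $ 1 + Const3 (M $ i $ 2) * G $ 2 + Const3 (M $ i $ 3) * G $ 3"
proof -
  interpret comm_ring_map "\<lambda>p. subst3 p G" by (rule comm_ring_map_subst3)
  show ?thesis
    by (simp only: pm_linear_def vec_lambda_beta sum_3 Var3_def vector_3 add mult subst3_simps)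
qed

lemma subst3_shear:
  assumes "G $ 1 = X3" "G $ 2 = Const3 c * X3 + Y3" "G $ 3 = Z3"
  shows "subst3 p G = map_poly (shear c) p"
proof -
  have r: "subst1 r X3 = [:[:r:]:]" for r :: "'a poly"
    by (induction r) (simp_all add: subst1_pCons Const3_def)
  have G2: "G $ 2 = [:[:[:0, c:], 1:]:]" by (simp add: assms Const3_def one_pCons)
  have q: "poly (map_poly (\<lambda>r. subst1 r (G $ 1)) q) (G $ 2) = [:shear c q:]" for q
    by (induction q) (simp_all add: map_poly_pCons assms(1) r G2 shear_def pcompose_pCons)
  show ?thesis unfolding subst3_def q assms(3)
    by (induction p) (simp_all add: map_poly_pCons)
qed

text \<open>Composition with \<open>T\<close> on the right shears the variables; its inverse on the
  left subtracts c times the first component from the second, which removes ct from v.\<close>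

lemma pm_conj_shear:
  fixes c :: "'a::field"
  defines "T \<equiv> vector [vector [1, 0, 0], vector [c, 1, 0], vector [0, 0, 1]] :: 'a ^ 3 ^ 3"
  shows "invertible T"
    and "pm_conj T (vector [F1, F2, F3])
      = vector [map_poly (shear c) F1, map_poly (shear c) F2 - Const3 c * map_poly (shear c) F1,
                map_poly (shear c) F3]"
proof -
  define S :: "'a ^ 3 ^ 3" where "S = vector [vector [1, 0, 0], vector [- c, 1, 0], vector [0, 0, 1]]"
  have TS: "T ** S = mat 1" "S ** T = mat 1"
    by (simp_all add: T_def S_def vec_eq_iff forall_3 matrix_matrix_mult_def sum_3 mat_def)
  then show "invertible T" unfolding invertible_def by blast
  have inv: "matrix_inv T = S" using TS by (rule matrix_inv_eqI)
  have lin: "subst3 p (pm_linear T) = map_poly (shear c) p" for p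
    by (rule subst3_shear) (simp_all add: pm_linear_def sum_3 T_def Var3_def)
  have "Const3 (- c) = - Const3 c" by (simp add: Const3_def)
  then show "pm_conj T (vector [F1, F2, F3])
      = vector [map_poly (shear c) F1, map_poly (shear c) F2 - Const3 c * map_poly (shear c) F1,
                map_poly (shear c) F3]"
    unfolding vec3_eq_iff pm_conj_def inv pm_comp_def vec_lambda_beta subst3_pm_linear lin
    by (simp add: S_def)
qed

section \<open>The nilpotency equations of the map and the proof of the theorem\<close>

lemma jacobian_nilpotent:
  fixes u F :: "'a::field poly3" and h :: "'a poly2"
  assumes "nilpotent_matrix (jacobian (vector [u, F, [:h:]]))"
  shows "dX3 u + dY3 F = 0"
    and "dX3 u * dY3 F - dY3 u * dX3 F - dZ u * [:dX h:] - dZ F * [:dY h:] = 0"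
    and "dY3 u * dZ F * [:dX h:] + dZ u * dX3 F * [:dY h:] - dX3 u * dZ F * [:dY h:]
           - dZ u * dY3 F * [:dX h:] = 0"
proof -
  define A where "A = jacobian (vector [u, F, [:h:]])"
  have A: "A$1$1 = dX3 u" "A$1$2 = dY3 u" "A$1$3 = dZ u" "A$2$1 = dX3 F" "A$2$2 = dY3 F"
    "A$2$3 = dZ F" "A$3$1 = [:dX h:]" "A$3$2 = [:dY h:]" "A$3$3 = 0"
    by (simp_all add: A_def jacobian_def grad3_def)
  note n = nilpotent_matrix_3[OF assms, folded A_def, unfolded det_3 A]
  show "dX3 u + dY3 F = 0" using n(1) by simp
  show "dX3 u * dY3 F - dY3 u * dX3 F - dZ u * [:dX h:] - dZ F * [:dY h:] = 0"
    using n(2) by (simp add: algebra_simps)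
  show "dY3 u * dZ F * [:dX h:] + dZ u * dX3 F * [:dY h:] - dX3 u * dZ F * [:dY h:]
           - dZ u * dY3 F * [:dX h:] = 0"
    using n(3) by (simp add: algebra_simps)
qed

lemma pm_lin_indepD:
  assumes "pm_lin_indep (vector [F1, F2, F3])"
    and "Const3 a * F1 + Const3 b * F2 + Const3 c * F3 = 0"
  shows "a = 0" "b = 0" "c = 0"
proof -
  have "(vector [a, b, c] :: 'a ^ 3) = 0"
    using assms unfolding pm_lin_indep_def by (elim allE[of _ "vector [a, b, c]"]) (simp add: sum_3)
  then show "a = 0" "b = 0" "c = 0" by (simp_all add: vec_eq_iff forall_3)
qed

theorem theorem3p3:
  fixes u v :: "'a::{alg_closed_field, field_char_0} poly3"
    and h :: "'a poly2"
    and H :: "'a polymap"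
  assumes H_def: "H = vector [u, pcompose v u, [:h:]]"
    and H_zero: "pm_eval H 0 = 0"
    and H_indep: "pm_lin_indep H"
    and JH_nilpotent: "nilpotent_matrix (jacobian H)"
    and gcd_le: "gcd (total_degree2 (poly v 0)) (total_degree2 h) \<le> 3"
  shows "\<exists>T :: 'a ^ 3 ^ 3. invertible T \<and>
    (\<exists>(U :: 'a poly3) (V :: 'a poly3) (W :: 'a poly3)
        (u1 :: 'a) (c0 :: 'a) (a :: 'a) (l1 :: 'a) (l2 :: 'a) (l2' :: 'a)
        (b :: 'a poly) (g :: 'a poly).
      u1 \<noteq> 0 \<and> c0 \<noteq> 0 \<and> a \<noteq> 0 \<and>
      b = [:l2', l1, u1 * c0 * a:] \<and>
      poly g 0 = 0 \<and> degree g \<ge> 1 \<and>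
      pm_conj T H = vector [U, V, W] \<and>
      U = Const3 u1 * Z3
            - Const3 (inverse a) * subst1 (pderiv b) Y3 * subst1 g (Const3 a * X3 + subst1 b Y3)
            - Const3 (u1 * l2) * Y3 \<and>
      V = subst1 g (Const3 a * X3 + subst1 b Y3) \<and>
      W = Const3 c0 * V ^ 2 + Const3 l2 * V)"
proof -
  define F where "F = pcompose v u"
  have indep: "a = 0 \<and> b = 0 \<and> c = 0" if "Const3 a * u + Const3 b * F + Const3 c * [:h:] = 0" for a b c
    using pm_lin_indepD[OF H_indep[unfolded H_def, folded F_def] that] by simp
  have zero: "ev2 (coeff u 0) 0 0 = 0" "ev2 (coeff F 0) 0 0 = 0" "ev2 h 0 0 = 0"
    using H_zero unfolding H_def by (simp_all add: vec_eq_iff forall_3 pm_eval_def ev2_def F_def poly_0_coeff_0)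
  note J = jacobian_nilpotent[OF JH_nilpotent[unfolded H_def, folded F_def]]

  have hnc: "dX h \<noteq> 0 \<or> dY h \<noteq> 0"
  proof (rule ccontr)
    assume "\<not> ?thesis"
    then obtain c where "h = [:[:c:]:]" using dX_dY_eq_0_imp_const by metis
    with zero have "h = 0" by simp
    then show False using indep[of 0 0 1] by simp
  qed

  have uz: "dZ u \<noteq> 0"
  proof
    assume "dZ u = 0"
    then obtain p where p: "u = [:p:]" by (metis degree_eq_zeroE pderiv_eq_0_iff)
    define q where "q = poly v p"
    have q: "F = [:q:]" by (simp add: F_def q_def p pcompose_pCons_0)
    \<comment> \<open>Without z, the trace and minor conditions are those of the planar map (p, q),
      so \<open>planar_nilpotent\<close> applies with - p as \<open>P\<close>.\<close>
    have t: "dX p + dY q = 0" and m: "dX p * dY q - dY p * dX q = 0"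
      using J(1,2) by (simp_all add: p q mult.commute)
    have "dX (- p) = dY q" using t unfolding dX.minus by (rule minus_unique)
    moreover have "(dY q)\<^sup>2 = dX q * dY (- p)" unfolding dY.minus using t m by algebra
    ultimately consider c where "q = [:[:c:]:]" | s c where "- p = [:[:s:]:] * q + [:[:c:]:]"
      using planar_nilpotent by blast
    then show False
    proof cases
      case 1
      with zero q have "F = 0" by simp
      then show False using indep[of 0 1 0] by simp
    next
      case 2
      have "ev2 (p + [:[:s:]:] * q + [:[:c:]:]) 0 0 = 0"
        using 2 by (metis add.right_inverse add.assoc ev2_simps(2) diff_self)
      then have "c = 0" using zero unfolding p q ev2_simps by simp
      with 2 have "p + [:[:s:]:] * q = 0"
        by (metis add.right_inverse add.right_neutral pCons_0_0)
      then have "Const3 1 * u + Const3 s * F + Const3 0 * [:h:] = 0"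
        by (simp add: p q Const3_def[of s])
      then show False using indep[of 1 s 0] by simp
    qed
  qed

  define V0 where "V0 = pcompose (pderiv v) u"
  have Fx: "dX3 F = pcompose (dX3 v) u + V0 * dX3 u" and Fy: "dY3 F = pcompose (dY3 v) u + V0 * dY3 u"
    and Fz: "dZ F = V0 * dZ u"
    by (simp_all add: F_def V0_def dX.map_pcompose dY.map_pcompose pderiv_pcompose)
  have T: "dX3 u + pcompose (dY3 v) u + V0 * dY3 u = 0" using J(1) unfolding Fy by (simp add: add.assoc)
  have Q: "dX3 u * pcompose (dY3 v) u - dY3 u * pcompose (dX3 v) u - dZ u * ([:dX h:] + V0 * [:dY h:]) = 0"
    using J(2) unfolding Fx Fy Fz by algebra
  \<comment> \<open>The terms with \<open>V0\<close> cancel in the determinant and u_z factors out.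
    Substituting the nonconstant \<open>u\<close> for t is injective, so the relation lifts to v
    itself.\<close>
  have "dZ u * (pcompose (dX3 v) u * [:dY h:] - pcompose (dY3 v) u * [:dX h:]) = 0"
    using J(3) unfolding Fx Fy Fz by algebra
  then have "pcompose (dX3 v * [:dY h:] - dY3 v * [:dX h:]) u = 0"
    using uz by (simp only: mult_eq_0_iff pcompose_diff pcompose_mult pcompose_const) simp
  moreover have "degree u > 0" using uz by (simp add: pderiv_eq_0_iff)
  ultimately have par: "dX3 v * [:dY h:] = dY3 v * [:dX h:]"
    using pcompose_eq_0 by fastforce

  have "degree v \<le> 1" by (rule degree_le_1_nilpotent[OF T[unfolded V0_def] Q[unfolded V0_def] par uz hnc])
  define v0 v1 where "v0 = coeff v 0" and "v1 = coeff v 1"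
  have v: "v = [:v0, v1:]" unfolding v0_def v1_def by (rule degree_le_1_eq) fact
  have "dX v1 = 0 \<and> dY v1 = 0"
    using linear_coeff_const_nilpotent[of u v0 v1 h, folded v, OF T[unfolded V0_def] Q[unfolded V0_def] par uz hnc] .
  then obtain c where c: "v1 = [:[:c:]:]" using dX_dY_eq_0_imp_const by metis
  have F: "F = [:v0:] + Const3 c * u"
    by (simp add: F_def v c Const3_def pcompose_pCons mult.commute)
  have zv0: "ev2 v0 0 0 = 0" using zero by (simp add: F Const3_def)
  have v0_nc: "v0 \<noteq> [:[:k:]:]" for k
  proof
    assume "v0 = [:[:k:]:]"
    with zv0 have "v0 = 0" by simp
    then have "Const3 (- c) * u + Const3 1 * F + Const3 0 * [:h:] = 0"
      by (simp add: F Const3.minus)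
    then show False using indep[of "- c" 1 0] by simp
  qed
  have h_v0: "h \<noteq> [:[:k:]:] * v0 + [:[:e:]:]" for k e
  proof
    assume h: "h = [:[:k:]:] * v0 + [:[:e:]:]"
    with zero zv0 have "e = 0" by simp
    with h have "[:h:] = Const3 k * [:v0:]" by (simp add: Const3_def)
    then have "Const3 (k * c) * u + Const3 (- k) * F + Const3 1 * [:h:] = 0"
      by (simp add: F Const3.minus Const3.mult algebra_simps)
    then show False using indep[of "k * c" "- k" 1] by simp
  qed

  \<comment> \<open>Shearing away the term ct and solving for the sheared map\<close>
  define u' v' h' where "u' = map_poly (shear c) u" and "v' = shear c v0" and "h' = shear c h"
  have V0: "V0 = [:[:[:c:]:]:]" by (simp add: V0_def v c pderiv_pCons)
  have par0: "dX v0 * dY h = dY v0 * dX h" using arg_cong[OF par, of "\<lambda>p. coeff p 0"] by (simp add: v mult.commute)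
  have dv: "pcompose (dX3 v) u = [:dX v0:]" "pcompose (dY3 v) u = [:dY v0:]"
    by (simp_all add: v c)
  note sh = shear_nilpotent[OF T[unfolded V0 dv] Q[unfolded V0 dv] par0, folded u'_def v'_def h'_def]
  have inj: "p = q" if "shear c p = shear c q" for p q using that by (metis shear_shear_minus)
  obtain P u1 where P: "u' = [:- P, [:[:u1:]:]:]" "u1 \<noteq> 0" "dX P = dY v'"
    "(dY v')\<^sup>2 + dX ([:[:u1:]:] * h') = dX v' * dY P" "dX v' \<noteq> 0"
  proof (rule linear_in_z_nilpotent[OF sh])
    show "dZ u' \<noteq> 0"
    proof
      assume "dZ u' = 0"
      then have z: "map_poly (shear c) (dZ u) = 0" by (simp add: u'_def dZ_shear)
      have "shear c (coeff (dZ u) n) = shear c 0" for n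
        using arg_cong[OF z, of "\<lambda>p. coeff p n"] by (simp add: coeff_map_poly)
      then have "coeff (dZ u) n = 0" for n by (rule inj)
      with uz show False by (simp add: poly_eq_iff)
    qed
    show "v' \<noteq> [:[:k:]:]" for k
      using v0_nc[of k] inj[of v0 "[:[:k:]:]"] unfolding v'_def shear_const by blast
    show "h' \<noteq> [:[:k:]:] * v' + [:[:e:]:]" for k e
      using h_v0[of k e] inj[of h "[:[:k:]:] * v0 + [:[:e:]:]"]
      unfolding v'_def h'_def shear.add shear.mult shear_const by blast
  qed
  \<comment> \<open>The potential equation contains h' only through u1 h', so this product takes the
    role of \<open>h\<close> in \<open>potential_normal_form\<close>.\<close>
  have par': "dX v' * dY ([:[:u1:]:] * h') = dY v' * dX ([:[:u1:]:] * h')"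
    unfolding dX.mult dY.mult using sh(3) by simp
  obtain B C m e e' where N: "dY v' = - [:[:B:], [:2 * C:]:] * dX v'"
    "P = [:[:e:], [:m:]:] - [:[:B:], [:2 * C:]:] * v'"
    "[:[:u1:]:] * h' = [:[:m:]:] * v' - [:[:C:]:] * v'\<^sup>2 + [:[:e':]:]"
    by (rule potential_normal_form[OF P(3,4) par' P(5)])
  have zv': "ev2 v' 0 0 = 0" and zh': "ev2 h' 0 0 = 0" by (simp_all add: v'_def h'_def ev2_shear_0 zv0 zero)
  have "ev2 P 0 0 = 0"
  proof -
    have "coeff u' 0 = shear c (coeff u 0)" by (simp add: u'_def coeff_map_poly)
    then have "shear c (coeff u 0) = - P" by (simp add: P(1))
    then have "ev2 (- P) 0 0 = 0" by (metis ev2_shear_0 zero(1))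
    then show ?thesis by (simp add: ev2_def)
  qed
  \<comment> \<open>The shear fixes the origin, so H(0) = 0 removes both integration
    constants.\<close>
  then have e: "e = 0" unfolding N(2) by (simp only: ev2_simps zv') (simp add: ev2_def)
  have e': "e' = 0"
    using arg_cong[OF N(3), of "\<lambda>p. ev2 p 0 0"] zv' zh'
    by (simp only: ev2_simps power2_eq_square) simp
  define g where "g = poly v' 0"
  define c0 l2 where "c0 = - C / u1" and "l2 = m / u1"
  have h'_eq: "h' = [:[:c0:]:] * v'\<^sup>2 + [:[:l2:]:] * v'"
  proof -
    have "[:[:u1:]:] * [:[:c0:]:] = - [:[:C:]:]" "[:[:u1:]:] * [:[:l2:]:] = [:[:m:]:]"
      using P(2) by (simp_all add: c0_def l2_def)
    moreover have "[:[:e':]:] = 0" by (simp add: e')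
    ultimately have "[:[:u1:]:] * h' = [:[:u1:]:] * ([:[:c0:]:] * v'\<^sup>2 + [:[:l2:]:] * v')"
      using N(3) by algebra
    moreover have "[:[:u1:]:] \<noteq> 0" using P(2) by simp
    ultimately show ?thesis by (metis mult_left_cancel)
  qed
  \<comment> \<open>Otherwise h would be a scalar multiple of \<open>v0\<close>, against linear
    independence.\<close>
  have "c0 \<noteq> 0"
  proof
    assume "c0 = 0"
    then have "shear c h = shear c ([:[:l2:]:] * v0 + [:[:0:]:])"
      using h'_eq by (simp add: h'_def v'_def shear.mult del: mult_pCons_left)
    then have "h = [:[:l2:]:] * v0 + [:[:0:]:]" by (rule inj)
    with h_v0 show False by blast
  qed
  have C: "u1 * c0 = - C" and m: "u1 * l2 = m" using P(2) by (simp_all add: c0_def l2_def)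
  \<comment> \<open>The witnesses are a = 1, l1 = - B and constant term 0. As u1 c0 = - C, the
    argument ax + b(y) is x - By - Cy^2.\<close>
  define b where "b = [:0, - B, u1 * c0 * 1:]"
  have vg: "v' = poly (map_poly const2 g) [:[:0, 1:], [:- B:], [:- C:]:]"
    unfolding g_def by (rule transport_solution[OF N(1)])
  have arg: "Const3 1 * X3 + subst1 b Y3 = [:[:[:0, 1:], [:- B:], [:- C:]:]:]"
    by (simp add: b_def subst1_pCons Const3_def C one_pCons)
  have "Const3 k = [:const2 k:]" for k :: 'a by (simp add: Const3_def const2_def)
  then have sub: "subst1 g [:r:] = [:poly (map_poly const2 g) r:]" for r
    unfolding subst1_def
    by (induction g) (simp_all add: Const3.eval_pCons comm_ring_map.eval_pCons[OF comm_ring_map_const2])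
  have V: "[:v':] = subst1 g (Const3 1 * X3 + subst1 b Y3)" unfolding arg sub vg[symmetric] ..
  have db: "subst1 (pderiv b) Y3 = [:- [:[:B:], [:2 * C:]:]:]"
    by (simp add: b_def pderiv_pCons subst1_pCons Const3_def C one_pCons)
  \<comment> \<open>Here u' = u1 z - P with P = my - (B + 2Cy)v', and b' = - (B + 2Cy), so the last
    term of P supplies - b' g.\<close>
  have U: "u' = Const3 u1 * Z3 - Const3 (inverse 1) * subst1 (pderiv b) Y3 * [:v':] - Const3 (u1 * l2) * Y3"
  proof -
    define q where "q = [:[:B:], [:2 * C:]:]"
    show ?thesis
      unfolding P(1) N(2) e db m q_def[symmetric]
      by (simp add: Const3_def[of u1] Const3_def[of m] mult.commute)
  qed
  have W: "[:h':] = Const3 c0 * [:v':] ^ 2 + Const3 l2 * [:v':]"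
    unfolding h'_eq by (simp add: Const3_def power2_eq_square)
  have g0: "poly g 0 = 0" using zv' by (simp add: g_def ev2_def)
  have "g \<noteq> 0"
  proof
    assume "g = 0"
    then have "v' = 0" using vg by simp
    with P(5) show False by simp
  qed
  with g0 have "degree g \<ge> 1" by (metis One_nat_def Suc_leI degree_eq_zeroE neq0_conv pCons_0_0 poly_const_conv)
  define M :: "'a ^ 3 ^ 3" where "M = vector [vector [1, 0, 0], vector [c, 1, 0], vector [0, 0, 1]]"
  have conj: "pm_conj M H = vector [u', [:v':], [:h':]]"
    unfolding H_def F_def[symmetric] M_def pm_conj_shear(2)
    unfolding F shear3.add shear3.mult
    by (simp add: u'_def v'_def h'_def Const3_def)
  show ?thesis
  proof (intro exI conjI)
    show "invertible M" unfolding M_def by (rule pm_conj_shear(1))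
    show "u1 \<noteq> 0" by fact
    show "c0 \<noteq> 0" by fact
    show "(1 :: 'a) \<noteq> 0" by simp
  qed (fact b_def g0 \<open>degree g \<ge> 1\<close> conj U[unfolded V] V W)+
qed

end
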